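(* Let $V_h, V_{2h}, \Lambda_h$ be the finite element spaces of either Element 1 or Element 2 (defined in the context), and assume that the coefficients satisfy $\beta_2>\beta>\underline{\beta}>0$ in $\Omega_2$, where $\underline\beta$ is a constant. Let $$\mathbb{K}_h=\{(v_h,v_{2h})\in V_h\times V_{2h}:\ (\mu_h, v_h|_{\Omega_2}-v_{2h})_{\Omega_2}=0\ \ \forall \mu_h\in\Lambda_h\}.$$ Then there exists a constant $\gamma_1>0$, independent of the discretization parameters $h,h_2$, such that for all $(v_h,v_{2h})\in\mathbb{K}_h$ $$(\beta\nabla v_h,\nabla v_h)_{\Omega}+((\beta_2-\beta)\nabla v_{2h},\nabla v_{2h})_{\Omega_2}\ \ge\ \gamma_1\left[\|v_h\|_{V}^2+\|v_{2h}\|_{V_2}^2\right].$$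
   Context: Domains. $\Omega\subset\mathbb{R}^d$, $d=1,2,3$, is a bounded domain with Lipschitz boundary, subdivided into two subdomains $\Omega_1,\Omega_2$ with $\overline\Omega=\overline\Omega_1\cup\overline\Omega_2$, separated by a Lipschitz continuous interface $\Gamma=\overline\Omega_1\cap\overline\Omega_2$; $\Omega_2$ is immersed in $\Omega$, so that $\overline\Gamma\cap\partial\Omega=\emptyset$. $(\cdot,\cdot)_\omega$ is the $L^2(\omega)$ scalar product, $\|\cdot\|_{0,\omega}$ the $L^2(\omega)$ norm, $\|\cdot\|_{1,\omega}$ the $H^1(\omega)$ norm. Coefficients. $\beta\in L^\infty(\Omega)$ and $\beta_2\in L^\infty(\Omega_2)$; $\beta$ is an extension to $\Omega$ of a coefficient $\beta_1\in L^\infty(\Omega_1)$, and there are constants $\underline\beta_1,\underline\beta_2>0$ with $\beta_1>\underline\beta_1$ in $\Omega_1$ and $\beta_2>\underline\beta_2$ in $\Omega_2$. Spaces. $V=H^1_0(\Omega)$ with norm $\|v\|_V=\|\nabla v\|_{0,\Omega}$; $V_2=H^1(\Omega_2)$ with norm $\|v_2\|_{V_2}=\|v_2\|_{1,\Omega_2}$; $\Lambda=[H^1(\Omega_2)]^*$ is the dual of $V_2$. Functions $\mu\in L^2(\Omega_2)$ are regarded as elements of $\Lambda$ through the $L^2(\Omega_2)$ scalar product. Meshes. $\mathcal{T}$ and $\mathcal{T}_2$ are shape-regular meshes of $\Omega$ and $\Omega_2$ respectively, made of quadrilaterals in 2D and hexahedra in 3D, with maximum mesh sizes $h$ and $h_2$.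 For an element $K$ and $k\ge1$, $Q_k(K)$ is the space of finite element functions on $K$ that are polynomials of degree at most $k$ separately in each variable (understood, as usual, through the map from the reference square or cube); $P_0(K)$ is the space of constants on $K$; $B(K)$ is the one-dimensional space spanned by a bubble function in $Q_2(K)$ vanishing on $\partial K$. Element 1 ($Q_1-(Q_1+B)-P_0$): $V_h=\{v\in V: v|_K\in Q_1(K)\ \forall K\in\mathcal{T}\}$, $V_{2h}=\{v\in V_2: v|_K\in Q_1(K)+B(K)\ \forall K\in\mathcal{T}_2\}$, $\Lambda_h=\{\mu\in\Lambda:\mu|_K\in P_0(K)\ \forall K\in\mathcal{T}_2\}$ (piecewise constants on $\mathcal{T}_2$). Element 2 ($Q_2-Q_2-P_0$): $V_h=\{v\in V: v|_K\in Q_2(K)\ \forall K\in\mathcal{T}\}$, $V_{2h}=\{v\in V_2: v|_K\in Q_2(K)\ \forall K\in\mathcal{T}_2\}$, and $\Lambda_h$ as in Element 1.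
   Formalization: The assumption β2 > β in Ω2 is taken uniformly, β2 ≥ β + δ a.e. for some constant δ > 0; with mere strict inequality (e.g. β = 1, β2 = 1 + |x − x0|) no γ1 independent of h2 exists. *)

theory Defs
  imports "HOL-Analysis.Analysis"
begin

section \<open>Lebesgue and Sobolev spaces\<close>

text \<open>Elements of L2, H1 etc. are represented by functions on the whole space; only their
  values almost everywhere on the domain \<open>S\<close> matter, so restriction to a subdomain is
  the same function considered with the smaller \<open>S\<close>.\<close>

definition L2 :: "'a::euclidean_space set \<Rightarrow> ('a \<Rightarrow> 'b::euclidean_space) set" where
  "L2 S = {f. f \<in> borel_measurable (lebesgue_on S) \<and>
              integrable (lebesgue_on S) (\<lambda>x. (norm (f x))\<^sup>2)}"

definition l2_inner ::
    "'a::euclidean_space set \<Rightarrow> ('a \<Rightarrow> 'b::euclidean_space) \<Rightarrow> ('a \<Rightarrow> 'b) \<Rightarrow> real" where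
  "l2_inner S f g = (LINT x|lebesgue_on S. f x \<bullet> g x)"

definition l2_norm :: "'a::euclidean_space set \<Rightarrow> ('a \<Rightarrow> 'b::euclidean_space) \<Rightarrow> real" where
  "l2_norm S f = sqrt (l2_inner S f f)"

definition Linfty :: "'a::euclidean_space set \<Rightarrow> ('a \<Rightarrow> real) set" where
  "Linfty S = {f. f \<in> borel_measurable (lebesgue_on S) \<and>
                  (\<exists>M. AE x in lebesgue_on S. \<bar>f x\<bar> \<le> M)}"

text \<open>Strict inequality between two variable coefficients of class \<open>Linfty\<close> is understood
  in the uniform sense: the difference has a positive essential infimum, i.e. it is an interior
  point of the cone of nonnegative functions. (If the difference were merely positive almost
  everywhere with essential infimum zero, no coercivity constant could be uniform over all
  meshes.)\<close>

definition ess_greater :: "'a::euclidean_space set \<Rightarrow> ('a \<Rightarrow> real) \<Rightarrow> ('a \<Rightarrow> real) \<Rightarrow> bool" where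
  "ess_greater S f g \<longleftrightarrow> (\<exists>\<delta>>0. AE x in lebesgue_on S. f x \<ge> g x + \<delta>)"

definition grad :: "(real^'n \<Rightarrow> real) \<Rightarrow> real^'n \<Rightarrow> real^'n" where
  "grad f x = (\<chi> i. frechet_derivative f (at x) (axis i 1))"

primrec Ck :: "nat \<Rightarrow> (real^'n \<Rightarrow> real) \<Rightarrow> bool" where
  "Ck 0 f \<longleftrightarrow> continuous_on UNIV f"
| "Ck (Suc k) f \<longleftrightarrow> (\<forall>x. f differentiable (at x)) \<and> (\<forall>i. Ck k (\<lambda>x. grad f x $ i))"

definition test_functions :: "(real^'n) set \<Rightarrow> (real^'n \<Rightarrow> real) set" where
  "test_functions S = {\<phi>. (\<forall>k. Ck k \<phi>) \<and>
     compact (closure {x. \<phi> x \<noteq> 0}) \<and> closure {x. \<phi> x \<noteq> 0} \<subseteq> S}"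

definition has_weak_gradient ::
    "(real^'n) set \<Rightarrow> (real^'n \<Rightarrow> real) \<Rightarrow> (real^'n \<Rightarrow> real^'n) \<Rightarrow> bool" where
  "has_weak_gradient S v g \<longleftrightarrow> (\<forall>\<phi>\<in>test_functions S. \<forall>i.
     (LINT x|lebesgue_on S. v x * grad \<phi> x $ i) = - (LINT x|lebesgue_on S. g x $ i * \<phi> x))"

definition H1 :: "(real^'n) set \<Rightarrow> (real^'n \<Rightarrow> real) set" where
  "H1 S = {v \<in> L2 S. \<exists>g\<in>L2 S. has_weak_gradient S v g}"

text \<open>A representative of the weak gradient, which is unique up to null sets.\<close>

definition wgrad :: "(real^'n) set \<Rightarrow> (real^'n \<Rightarrow> real) \<Rightarrow> real^'n \<Rightarrow> real^'n" where
  "wgrad S v = (SOME g. g \<in> L2 S \<and> has_weak_gradient S v g)"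

definition h1_norm :: "(real^'n) set \<Rightarrow> (real^'n \<Rightarrow> real) \<Rightarrow> real" where
  "h1_norm S v = sqrt ((l2_norm S v)\<^sup>2 + (l2_norm S (wgrad S v))\<^sup>2)"

text \<open>The closure of the test functions in H1, with the norm of \<open>v - \<phi> n\<close> written out.\<close>

definition H10 :: "(real^'n) set \<Rightarrow> (real^'n \<Rightarrow> real) set" where
  "H10 S = {v \<in> H1 S. \<exists>\<phi>. (\<forall>n::nat. \<phi> n \<in> test_functions S) \<and>
     (\<lambda>n. l2_norm S (\<lambda>x. v x - \<phi> n x)) \<longlonglongrightarrow> 0 \<and>
     (\<lambda>n. l2_norm S (\<lambda>x. wgrad S v x - grad (\<phi> n) x)) \<longlonglongrightarrow> 0}"

definition V_norm :: "(real^'n) set \<Rightarrow> (real^'n \<Rightarrow> real) \<Rightarrow> real" where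
  "V_norm \<Omega> v = l2_norm \<Omega> (wgrad \<Omega> v)"


section \<open>Domains and interface\<close>

text \<open>Locally, \<open>\<Omega>\<close> is the part below the graph of a Lipschitz function over the hyperplane
  orthogonal to some unit vector \<open>e\<close>. In dimension one this hyperplane is \<open>{0}\<close>, and the
  bounded Lipschitz domains are the bounded open intervals.\<close>

definition lipschitz_domain :: "(real^'n) set \<Rightarrow> bool" where
  "lipschitz_domain \<Omega> \<longleftrightarrow> open \<Omega> \<and> connected \<Omega> \<and> bounded \<Omega> \<and> \<Omega> \<noteq> {} \<and>
     (\<forall>x\<in>frontier \<Omega>. \<exists>r>0. \<exists>e \<psi> L. norm e = 1 \<and> L-lipschitz_on {z. z \<bullet> e = 0} \<psi> \<and>
        \<Omega> \<inter> ball x r = {y \<in> ball x r. y \<bullet> e < \<psi> (y - (y \<bullet> e) *\<^sub>R e)})"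

text \<open>\<open>\<Omega>2\<close> is immersed in \<open>\<Omega>\<close>, hence the interface is the boundary of \<open>\<Omega>2\<close>, and it is
  Lipschitz because \<open>\<Omega>2\<close> is a Lipschitz domain. \<open>\<Omega>1\<close> is not required to be connected: in
  dimension one it never is.\<close>

definition interface_configuration ::
    "(real^'n) set \<Rightarrow> (real^'n) set \<Rightarrow> (real^'n) set \<Rightarrow> bool" where
  "interface_configuration \<Omega> \<Omega>1 \<Omega>2 \<longleftrightarrow>
     lipschitz_domain \<Omega> \<and> open \<Omega>1 \<and> lipschitz_domain \<Omega>2 \<and>
     \<Omega>1 \<inter> \<Omega>2 = {} \<and> closure \<Omega> = closure \<Omega>1 \<union> closure \<Omega>2 \<and> closure \<Omega>2 \<subseteq> \<Omega> \<and>
     (let \<Gamma> = closure \<Omega>1 \<inter> closure \<Omega>2 in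
        \<Omega> = \<Omega>1 \<union> \<Gamma> \<union> \<Omega>2 \<and> closure \<Gamma> \<inter> frontier \<Omega> = {})"


section \<open>Meshes of quadrilaterals and hexahedra\<close>

abbreviation ref_cube :: "(real^'n) set" where
  "ref_cube \<equiv> cbox 0 1"

text \<open>Polynomials of degree at most \<open>k\<close> separately in each variable.\<close>

definition Q_ref :: "nat \<Rightarrow> (real^'n \<Rightarrow> real) set" where
  "Q_ref k = {p. \<exists>c. \<forall>x. p x = (\<Sum>\<alpha> | \<forall>i. \<alpha> i \<le> k. c \<alpha> * (\<Prod>i\<in>UNIV. (x $ i) ^ \<alpha> i))}"

text \<open>An element is given by its map \<open>F\<close> from the reference cube, with multilinear components;
  the element itself is \<open>F ` ref_cube\<close> (a segment, a quadrilateral or a hexahedron).\<close>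

definition element_map :: "(real^'n \<Rightarrow> real^'n) \<Rightarrow> bool" where
  "element_map F \<longleftrightarrow> (\<forall>i. (\<lambda>x. F x $ i) \<in> Q_ref 1) \<and> inj_on F ref_cube \<and>
     (\<forall>x\<in>ref_cube. det (matrix (frechet_derivative F (at x))) \<noteq> 0)"

text \<open>Face-to-face conformity is not required of a mesh (hanging nodes are allowed);
  conformity of the discrete spaces comes from their being subspaces of H1.\<close>

definition mesh :: "(real^'n) set \<Rightarrow> (real^'n \<Rightarrow> real^'n) set \<Rightarrow> bool" where
  "mesh \<Omega> T \<longleftrightarrow> finite T \<and> (\<forall>F\<in>T. element_map F) \<and>
     (\<Union>F\<in>T. F ` ref_cube) = closure \<Omega> \<and>
     (\<forall>F\<in>T. \<forall>G\<in>T. F \<noteq> G \<longrightarrow> interior (F ` ref_cube) \<inter> interior (G ` ref_cube) = {})"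

text \<open>The diameter of every element is at most \<open>\<sigma>\<close> times the diameter of a ball inscribed in it.\<close>

definition shape_regular :: "real \<Rightarrow> (real^'n \<Rightarrow> real^'n) set \<Rightarrow> bool" where
  "shape_regular \<sigma> T \<longleftrightarrow>
     (\<forall>F\<in>T. \<exists>z r. 0 < r \<and> cball z r \<subseteq> F ` ref_cube \<and> diameter (F ` ref_cube) \<le> \<sigma> * (2 * r))"


section \<open>Finite element spaces\<close>

definition Q_space :: "nat \<Rightarrow> (real^'n \<Rightarrow> real^'n) \<Rightarrow> (real^'n \<Rightarrow> real) set" where
  "Q_space k F = {q. \<exists>p\<in>Q_ref k. \<forall>x\<in>ref_cube. q (F x) = p x}"

text \<open>Up to a factor, the product below is the only member of \<open>Q_ref 2\<close> that vanishes on the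
  boundary of the reference cube.\<close>

definition bubble_space :: "(real^'n \<Rightarrow> real^'n) \<Rightarrow> (real^'n \<Rightarrow> real) set" where
  "bubble_space F = {q. \<exists>c. \<forall>x\<in>ref_cube. q (F x) = c * (\<Prod>i\<in>UNIV. x $ i * (1 - x $ i))}"

definition Q1_bubble_space :: "(real^'n \<Rightarrow> real^'n) \<Rightarrow> (real^'n \<Rightarrow> real) set" where
  "Q1_bubble_space F = {\<lambda>x. q x + b x | q b. q \<in> Q_space 1 F \<and> b \<in> bubble_space F}"

definition P0_space :: "(real^'n \<Rightarrow> real^'n) \<Rightarrow> (real^'n \<Rightarrow> real) set" where
  "P0_space F = {q. \<exists>c. \<forall>x\<in>F ` ref_cube. q x = c}"

definition piecewise ::
    "((real^'n \<Rightarrow> real^'n) \<Rightarrow> (real^'n \<Rightarrow> real) set) \<Rightarrow> (real^'n \<Rightarrow> real^'n) set \<Rightarrow>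
     (real^'n \<Rightarrow> real) set" where
  "piecewise P T = {v. \<forall>F\<in>T. \<exists>q\<in>P F. AE x in lebesgue_on (F ` ref_cube). v x = q x}"

datatype fe_choice = Q1_Q1B_P0 | Q2_Q2_P0

fun V_h :: "fe_choice \<Rightarrow> (real^'n) set \<Rightarrow> (real^'n \<Rightarrow> real^'n) set \<Rightarrow> (real^'n \<Rightarrow> real) set" where
  "V_h Q1_Q1B_P0 \<Omega> T = H10 \<Omega> \<inter> piecewise (Q_space 1) T"
| "V_h Q2_Q2_P0 \<Omega> T = H10 \<Omega> \<inter> piecewise (Q_space 2) T"

fun V_2h :: "fe_choice \<Rightarrow> (real^'n) set \<Rightarrow> (real^'n \<Rightarrow> real^'n) set \<Rightarrow> (real^'n \<Rightarrow> real) set" where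
  "V_2h Q1_Q1B_P0 \<Omega>2 T2 = H1 \<Omega>2 \<inter> piecewise Q1_bubble_space T2"
| "V_2h Q2_Q2_P0 \<Omega>2 T2 = H1 \<Omega>2 \<inter> piecewise (Q_space 2) T2"

text \<open>The multipliers are square integrable functions, which act on H1 through the L2 scalar
  product; their space is the same for both choices of elements.\<close>

definition Lambda_h ::
    "(real^'n) set \<Rightarrow> (real^'n \<Rightarrow> real^'n) set \<Rightarrow> (real^'n \<Rightarrow> real) set" where
  "Lambda_h \<Omega>2 T2 = L2 \<Omega>2 \<inter> piecewise P0_space T2"

definition K_h :: "fe_choice \<Rightarrow> (real^'n) set \<Rightarrow> (real^'n) set \<Rightarrow> (real^'n \<Rightarrow> real^'n) set \<Rightarrow>
    (real^'n \<Rightarrow> real^'n) set \<Rightarrow> ((real^'n \<Rightarrow> real) \<times> (real^'n \<Rightarrow> real)) set" where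
  "K_h el \<Omega> \<Omega>2 T T2 = {(v, v2). v \<in> V_h el \<Omega> T \<and> v2 \<in> V_2h el \<Omega>2 T2 \<and>
     (\<forall>\<mu>\<in>Lambda_h \<Omega>2 T2. l2_inner \<Omega>2 \<mu> (\<lambda>x. v x - v2 x) = 0)}"

end

theory Submission
  imports Defs
begin

text \<open>Constants belong to \<open>Lambda_h\<close> on every mesh, so a pair \<open>(v, v2)\<close> in \<open>K_h\<close> satisfies
  \<open>\<integral> v2 = \<integral> v\<close> over \<open>\<Omega>2\<close>. The Poincare inequality bounds the norm of \<open>v2\<close> by its gradient and this
  integral, and the Friedrichs inequality bounds the integral of \<open>v\<close> by the gradient of \<open>v\<close>. Neither
  constant involves the meshes.

  Poincare's inequality is obtained without compactness or extension operators. A function with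
  weak gradient \<open>g\<close> satisfies \<open>u (x + h) - u x = \<integral> g (x + t h) \<bullet> h dt\<close> over \<open>t \<in> [0, 1]\<close>, for almost every \<open>x\<close> whose
  segment stays in the domain. Hence the mean square difference of \<open>u\<close> between two sets \<open>A\<close> and \<open>B\<close>
  is controlled by \<open>g\<close> as soon as all segments from \<open>A\<close> to \<open>B\<close> lie in the domain, and such control is
  transitive. Balls inside the domain see themselves, pieces near a Lipschitz boundary see a ball
  inside, and connectedness and compactness link the domain to itself.\<close>

section \<open>Test functions approximating boxes\<close>

text \<open>The quantity that is chained is not the distance of \<open>u\<close> to its mean but the
  double integral \<open>gap\<close> of squared differences. It makes sense without integrability,
  obeys a triangle inequality through any intermediate set of positive finite measure, and for
  \<open>S\<close> paired with itself equals 2|S| times the integral of u^2 minus twice the squared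
  integral of u, so the mean appears only at the very end.

  Two obstacles shape the estimate along segments. The difference formula holds outside a null set
  that depends on \<open>h\<close>, which forces the variables \<open>(x, h)\<close> and the order
  of integration. And averaging over the points \<open>x + t (y - x)\<close> degenerates in
  \<open>y\<close> as t tends to 0 and in \<open>x\<close> as t tends to 1, so each variable serves
  for one half of the range of t.

  Weak gradients are tested with smooth functions, so the fundamental lemma needs explicit smooth
  cutoffs. Lipschitz charts are used a second time at the end: the coefficient \<beta> is bounded
  below on \<Omega>1 and on \<Omega>2 separately, and the bound on all of \<Omega> requires the
  interface to be a null set.\<close>

definition flat_exp :: "real poly \<Rightarrow> real \<Rightarrow> real" where
  "flat_exp P t = (if t > 0 then poly P (1 / t) * exp (- (1 / t)) else 0)"

text \<open>The derivative of P(1/t) exp(-1/t) is (P - P')(1/t) exp(-1/t) / t^2. In the variable s =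
  1/t the polynomial factor is thus s^2 (P - P'), and the family \<open>flat_exp\<close> is closed
  under differentiation.\<close>

definition flat_step :: "real poly \<Rightarrow> real poly" where
  "flat_step P = [:0, 0, 1:] * (P - pderiv P)"

lemma tendsto_poly_mult_exp_neg: "((\<lambda>s::real. poly P s * exp (- s)) \<longlongrightarrow> 0) at_top"
proof -
  have "((\<lambda>s::real. \<Sum>i\<le>degree P. coeff P i * (s ^ i / exp s)) \<longlongrightarrow> (\<Sum>i\<le>degree P. coeff P i * 0)) at_top"
    by (intro tendsto_intros tendsto_power_div_exp_0)
  moreover have "(\<Sum>i\<le>degree P. coeff P i * (s ^ i / exp s)) = poly P s * exp (- s)" for s :: real
    by (simp add: poly_altdef sum_distrib_right exp_minus divide_inverse mult.assoc)
  ultimately show ?thesis by simp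
qed

lemma DERIV_flat_exp: "(flat_exp P has_real_derivative flat_exp (flat_step P) t) (at t)"
proof -
  consider "t > 0" | "t < 0" | "t = 0" by linarith
  then show ?thesis
  proof cases
    case 1
    have "((\<lambda>t. poly P (1 / t) * exp (- (1 / t))) has_real_derivative
             poly (pderiv P) (1/t) * (- 1 / t^2) * exp (- (1 / t)) + poly P (1 / t) * (exp (-(1/t)) * (1 / t^2))) (at t)"
      using 1 by (auto intro!: derivative_eq_intros poly_DERIV[THEN DERIV_chain2] simp: power2_eq_square field_simps)
    also have "poly (pderiv P) (1/t) * (- 1 / t^2) * exp (- (1 / t)) + poly P (1 / t) * (exp (-(1/t)) * (1 / t^2))
        = flat_exp (flat_step P) t"
      using 1 by (simp add: flat_exp_def flat_step_def power2_eq_square field_simps)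
    finally show ?thesis
      by (rule has_field_derivative_transform_within_open[where S="{0<..}"]) (use 1 in \<open>auto simp: flat_exp_def\<close>)
  next
    case 2
    have "((\<lambda>t. 0) has_real_derivative flat_exp (flat_step P) t) (at t)"
      using 2 by (simp add: flat_exp_def)
    then show ?thesis
      by (rule has_field_derivative_transform_within_open[where S="{..<0}"]) (use 2 in \<open>auto simp: flat_exp_def\<close>)
  next
    case 3
    \<comment> \<open>With s = 1/h the right difference quotient at 0 equals s P(s) exp(-s); the
      division by h accounts for the extra factor \<open>[:0,1:]\<close>.\<close>
    have "((\<lambda>s. poly ([:0,1:] * P) s * exp (- s)) \<longlongrightarrow> 0) at_top"
      by (rule tendsto_poly_mult_exp_neg)
    then have "((\<lambda>h. poly ([:0,1:] * P) (inverse h) * exp (- (inverse h))) \<longlongrightarrow> 0) (at_right 0)"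
      by (rule filterlim_compose[OF _ filterlim_inverse_at_top_right])
    then have r: "((\<lambda>h. (flat_exp P h - flat_exp P 0) / (h - 0)) \<longlongrightarrow> 0) (at_right 0)"
      by (rule Lim_transform_eventually)
         (auto simp: eventually_at_filter flat_exp_def field_simps intro!: always_eventually)
    have l: "((\<lambda>h. (flat_exp P h - flat_exp P 0) / (h - 0)) \<longlongrightarrow> 0) (at_left 0)"
      by (rule Lim_transform_eventually[OF tendsto_const])
         (auto simp: eventually_at_filter flat_exp_def intro!: always_eventually)
    have "((\<lambda>h. (flat_exp P h - flat_exp P 0) / (h - 0)) \<longlongrightarrow> 0) (at 0)"
      using l r by (rule filterlim_split_at)
    then show ?thesis using 3 by (simp add: has_field_derivative_iff flat_exp_def)
  qed
qed

lemma flat_exp_nonneg: "flat_exp 1 t \<ge> 0"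
  by (simp add: flat_exp_def)

text \<open>A class of functions that contains bumps supported in boxes and is closed under
  partial differentiation; its members are therefore smooth.\<close>

inductive_set smooth_class :: "(real^'n \<Rightarrow> real) set" where
  const: "(\<lambda>x. c) \<in> smooth_class"
| flat: "(\<lambda>x. flat_exp P (s * x $ i + c)) \<in> smooth_class"
| add: "f \<in> smooth_class \<Longrightarrow> g \<in> smooth_class \<Longrightarrow> (\<lambda>x. f x + g x) \<in> smooth_class"
| mult: "f \<in> smooth_class \<Longrightarrow> g \<in> smooth_class \<Longrightarrow> (\<lambda>x. f x * g x) \<in> smooth_class"
| exp: "f \<in> smooth_class \<Longrightarrow> (\<lambda>x. exp (f x)) \<in> smooth_class"

lemma grad_nth:
  assumes "(f has_derivative f') (at x)"
  shows "grad f x $ j = f' (axis j 1)"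
  using frechet_derivative_at[OF assms] by (simp add: grad_def)

lemma smooth_class_deriv:
  assumes "f \<in> smooth_class"
  shows "(\<forall>x. f differentiable (at x)) \<and> (\<forall>j. (\<lambda>x. grad f x $ j) \<in> smooth_class)"
  using assms
proof induction
  case (const c)
  have "grad (\<lambda>x. c) x $ j = 0" for x :: "real^'a" and j
    by (subst grad_nth[OF has_derivative_const]) simp
  then show ?case by (auto intro: smooth_class.const)
next
  case (flat P s i c)
  have d: "((\<lambda>x. flat_exp P (s * x $ i + c)) has_derivative
      (\<lambda>h. flat_exp (flat_step P) (s * x $ i + c) * (s * h $ i))) (at x)" for x :: "real^'a"
    by (rule DERIV_flat_exp[THEN DERIV_compose_FDERIV, THEN has_derivative_eq_rhs])
       (auto intro!: derivative_eq_intros bounded_linear_imp_has_derivative bounded_linear_vec_nth)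
  have "(\<lambda>x. grad (\<lambda>x. flat_exp P (s * x $ i + c)) x $ j) =
      (\<lambda>x. flat_exp (flat_step P) (s * x $ i + c) * (s * axis j 1 $ i))" for j :: 'a
    by (rule ext) (rule grad_nth[OF d])
  then show ?case using d
    by (auto simp: differentiable_def intro!: smooth_class.intros)
next
  case (add f g)
  have d: "((\<lambda>x. f x + g x) has_derivative
      (\<lambda>h. frechet_derivative f (at x) h + frechet_derivative g (at x) h)) (at x)" for x
    using add by (intro derivative_intros) (auto simp: frechet_derivative_works)
  have "(\<lambda>x. grad (\<lambda>x. f x + g x) x $ j) = (\<lambda>x. grad f x $ j + grad g x $ j)" for j
    by (rule ext, subst grad_nth[OF d]) (simp add: grad_def)
  then show ?case using d add
    by (auto simp: differentiable_def intro!: smooth_class.intros)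
next
  case (mult f g)
  have d: "((\<lambda>x. f x * g x) has_derivative
      (\<lambda>h. f x * frechet_derivative g (at x) h + frechet_derivative f (at x) h * g x)) (at x)" for x
    using mult by (intro derivative_intros) (auto simp: frechet_derivative_works)
  have "(\<lambda>x. grad (\<lambda>x. f x * g x) x $ j) = (\<lambda>x. f x * grad g x $ j + grad f x $ j * g x)" for j
    by (rule ext, subst grad_nth[OF d]) (simp add: grad_def)
  then show ?case using d mult
    by (auto simp: differentiable_def intro!: smooth_class.intros)
next
  case (exp f)
  have d: "((\<lambda>x. exp (f x)) has_derivative
      (\<lambda>h. exp (f x) * frechet_derivative f (at x) h)) (at x)" for x
    using exp by (auto intro!: derivative_eq_intros simp: frechet_derivative_works)
  have "(\<lambda>x. grad (\<lambda>x. exp (f x)) x $ j) = (\<lambda>x. exp (f x) * grad f x $ j)" for j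
    by (rule ext, subst grad_nth[OF d]) (simp add: grad_def)
  then show ?case using d exp
    by (auto simp: differentiable_def intro!: smooth_class.intros)
qed

lemma smooth_class_Ck: "f \<in> smooth_class \<Longrightarrow> Ck k f"
proof (induction k arbitrary: f)
  case 0
  then show ?case using smooth_class_deriv
    by (auto intro!: continuous_at_imp_continuous_on differentiable_imp_continuous_within)
qed (use smooth_class_deriv in auto)

lemma smooth_class_prod:
  "finite I \<Longrightarrow> (\<And>i. i \<in> I \<Longrightarrow> f i \<in> smooth_class) \<Longrightarrow> (\<lambda>x. \<Prod>i\<in>I. f i x) \<in> smooth_class"
  by (induction I rule: finite_induct) (auto intro: smooth_class.intros)

definition box_bump :: "real^'n \<Rightarrow> real^'n \<Rightarrow> real^'n \<Rightarrow> real" where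
  "box_bump a b x = (\<Prod>i\<in>UNIV. flat_exp 1 (x $ i - a $ i) * flat_exp 1 (b $ i - x $ i))"

lemma box_bump_smooth: "box_bump a b \<in> smooth_class"
proof -
  have "(\<lambda>x. \<Prod>i\<in>UNIV. flat_exp 1 (1 * x $ i + - a $ i) * flat_exp 1 (- 1 * x $ i + b $ i)) \<in> smooth_class"
    by (intro smooth_class_prod smooth_class.intros) auto
  then show ?thesis by (simp add: box_bump_def[abs_def])
qed

lemma box_bump_nonneg: "box_bump a b x \<ge> 0"
  by (auto simp: box_bump_def intro!: prod_nonneg mult_nonneg_nonneg flat_exp_nonneg)

lemma box_bump_eq_0_iff: "box_bump a b x = 0 \<longleftrightarrow> x \<notin> box a b"
proof -
  have "flat_exp 1 t = 0 \<longleftrightarrow> \<not> t > 0" for t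
    by (simp add: flat_exp_def)
  then show ?thesis
    by (simp add: box_bump_def mem_box_cart)
qed

text \<open>Since the bump is positive exactly in the open box, 1 - exp(-n bump) tends to the
  indicator of the box while its support stays in the closed box for every n. The exponential rule
  of \<open>smooth_class\<close> exists for this function, and the form
  \<open>1 + (- 1) * ...\<close> matches the introduction rules.\<close>

definition box_cutoff :: "real^'n \<Rightarrow> real^'n \<Rightarrow> nat \<Rightarrow> real^'n \<Rightarrow> real" where
  "box_cutoff a b n x = 1 + (- 1) * exp (- real n * box_bump a b x)"

lemma box_cutoff_test_function:
  assumes "cbox a b \<subseteq> S"
  shows "box_cutoff a b n \<in> test_functions S"
proof -
  have "box_cutoff a b n \<in> smooth_class"
    unfolding box_cutoff_def[abs_def] by (intro smooth_class.intros box_bump_smooth)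
  moreover have "closure {x. box_cutoff a b n x \<noteq> 0} \<subseteq> cbox a b"
  proof (rule closure_minimal)
    have "{x. box_cutoff a b n x \<noteq> 0} \<subseteq> box a b"
      using box_bump_eq_0_iff[of a b] by (auto simp: box_cutoff_def)
    then show "{x. box_cutoff a b n x \<noteq> 0} \<subseteq> cbox a b"
      using box_subset_cbox by blast
  qed (rule closed_cbox)
  ultimately show ?thesis using assms compact_cbox[of a b]
    by (auto simp: test_functions_def smooth_class_Ck
             intro: closed_subset compact_Int_closed[of "cbox a b", THEN compact_eq_bounded_closed[THEN iffD1, THEN conjunct1]]
                bounded_subset[OF bounded_cbox] simp: compact_eq_bounded_closed)
qed

lemma box_cutoff_bounds: "0 \<le> box_cutoff a b n x" "box_cutoff a b n x \<le> 1"
  by (auto simp: box_cutoff_def box_bump_nonneg)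

lemma box_cutoff_tendsto: "(\<lambda>n. box_cutoff a b n x) \<longlonglongrightarrow> indicator (box a b) x"
proof (cases "x \<in> box a b")
  case True
  then have p: "box_bump a b x > 0"
    using box_bump_nonneg[of a b x] box_bump_eq_0_iff[of a b x] by linarith
  have "(\<lambda>n. exp (- box_bump a b x) ^ n) \<longlonglongrightarrow> 0"
    by (rule LIMSEQ_realpow_zero) (use p in auto)
  then have "(\<lambda>n. 1 + (-1) * exp (- box_bump a b x) ^ n) \<longlonglongrightarrow> 1 + (-1) * 0"
    by (intro tendsto_add tendsto_mult tendsto_const)
  moreover have "exp (- box_bump a b x) ^ n = exp (- real n * box_bump a b x)" for n
    by (simp add: exp_of_nat_mult[symmetric])
  ultimately show ?thesis using True by (simp add: box_cutoff_def)
next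
  case False
  then show ?thesis using box_bump_eq_0_iff[of a b x] by (simp add: box_cutoff_def)
qed

section \<open>The fundamental lemma of the calculus of variations\<close>

text \<open>Open boxes form an intersection-stable generator of the Borel sets, so the vanishing of
  the integral spreads to all Borel sets by a Dynkin argument.\<close>

lemma AE_zero_if_box_integrals_zero:
  fixes f :: "real^'n \<Rightarrow> real"
  assumes f: "integrable lborel f"
    and z: "\<And>a b. (LINT x|lborel. f x * indicator (box a b) x) = 0"
  shows "AE x in lborel. f x = 0"
proof (rule sigma_finite_measure.density_zero[OF sigma_finite_lborel f])
  fix A :: "(real^'n) set" assume "A \<in> sets lborel"
  then have A: "A \<in> sigma_sets UNIV (range (\<lambda>(a, b). box a b :: (real^'n) set))"
    by (simp add: borel_eq_box)
  have Int: "Int_stable (range (\<lambda>(a, b). box a b :: (real^'n) set))"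
    by (auto simp: Int_stable_def box_Int_box)
  have sets: "B \<in> sets lborel" if "B \<in> sigma_sets UNIV (range (\<lambda>(a, b). box a b :: (real^'n) set))" for B
    using that by (simp add: borel_eq_box)
  \<comment> \<open>The complement step of the induction needs the integral over the whole space,
    obtained as the limit over growing cubes.\<close>
  have total: "(LINT x|lborel. f x) = 0"
  proof (rule LIMSEQ_unique)
    show "(\<lambda>n. LINT x|lborel. f x * indicator (box (- real n *\<^sub>R One) (real n *\<^sub>R One)) x) \<longlonglongrightarrow> (LINT x|lborel. f x)"
    proof (rule integral_dominated_convergence[where w = "\<lambda>x. \<bar>f x\<bar>"])
      show "AE x in lborel. (\<lambda>n. f x * indicator (box (- real n *\<^sub>R One) (real n *\<^sub>R One)) x) \<longlonglongrightarrow> f x"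
      proof (rule AE_I2)
        fix x :: "real^'n"
        obtain m :: nat where m: "norm x < m" using reals_Archimedean2 by blast
        have "x \<in> box (- real n *\<^sub>R One) (real n *\<^sub>R One)" if "n \<ge> m" for n
        proof -
          have "\<bar>x \<bullet> i\<bar> < n" if "i \<in> Basis" for i
            using Basis_le_norm[OF that, of x] m \<open>n \<ge> m\<close> by linarith
          then show ?thesis by (fastforce simp: mem_box abs_less_iff minus_less_iff)
        qed
        then show "(\<lambda>n. f x * indicator (box (- real n *\<^sub>R One) (real n *\<^sub>R One)) x) \<longlonglongrightarrow> f x"
          by (intro tendsto_eventually eventually_sequentiallyI[of m]) auto
      qed
    qed (use f in \<open>auto simp: indicator_def\<close>)
    show "(\<lambda>n. LINT x|lborel. f x * indicator (box (- real n *\<^sub>R One) (real n *\<^sub>R One)) x) \<longlonglongrightarrow> 0"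
      by (simp add: z)
  qed
  have intA: "set_integrable lborel B f" if "B \<in> sets lborel" for B
    using integrable_mult_indicator[OF that f] by (simp add: set_integrable_def)
  show "(LINT x:A|lborel. f x) = 0"
    using Int subset_UNIV[of "range (\<lambda>(a, b). box a b :: (real^'n) set)", folded Pow_UNIV] A
  proof (induction rule: sigma_sets_induct_disjoint)
    case (compl A)
    have "(LINT x:UNIV - A|lborel. f x) = (LINT x|lborel. f x - indicator A x *\<^sub>R f x)"
      unfolding set_lebesgue_integral_def by (intro Bochner_Integration.integral_cong) (auto simp: indicator_def)
    also have "\<dots> = (LINT x|lborel. f x) - (LINT x:A|lborel. f x)"
      using intA[OF sets[OF compl(1)]] f
      by (simp add: set_lebesgue_integral_def set_integrable_def)
    finally show ?case using compl total by simp
  next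
    case (union A)
    have "A i \<in> sets lborel" for i
      using union(2) sets by blast
    then have "(LINT x:(\<Union>i. A i)|lborel. f x) = (\<Sum>i. (LINT x:A i|lborel. f x))"
      using union(1)
      by (intro lebesgue_integral_countable_add intA) (auto simp: disjoint_family_on_def)
    then show ?case using union by simp
  qed (auto simp: set_lebesgue_integral_def z mult.commute)
qed

text \<open>The cutoffs of a box whose closed hull lies in \<open>U\<close> are admissible tests, so
  by dominated convergence \<open>f\<close> has integral zero over such boxes. Restricting
  \<open>f\<close> to one of them reduces the claim to the global case, and countably many of them
  cover \<open>U\<close>.\<close>

lemma fundamental_lemma_variations:
  fixes f :: "real^'n \<Rightarrow> real"
  assumes f: "integrable lborel f" and U: "open U"
    and z: "\<And>\<phi>. \<phi> \<in> test_functions U \<Longrightarrow> (LINT x|lborel. f x * \<phi> x) = 0"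
  shows "AE x in lborel. x \<in> U \<longrightarrow> f x = 0"
proof -
  have meas[measurable]: "box_cutoff a b n \<in> borel_measurable borel" for a b :: "real^'n" and n
    using box_cutoff_test_function[of a b UNIV n]
    by (auto simp: test_functions_def intro!: borel_measurable_continuous_onI dest: spec[of _ 0])
  have box0: "(LINT x|lborel. f x * indicator (box a b) x) = 0" if "cbox a b \<subseteq> U" for a b
  proof (rule LIMSEQ_unique)
    show "(\<lambda>n. LINT x|lborel. f x * box_cutoff a b n x) \<longlonglongrightarrow> (LINT x|lborel. f x * indicator (box a b) x)"
    proof (rule integral_dominated_convergence[where w = "\<lambda>x. \<bar>f x\<bar>"])
      show "AE x in lborel. (\<lambda>n. f x * box_cutoff a b n x) \<longlonglongrightarrow> f x * indicator (box a b) x"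
        by (intro AE_I2 tendsto_intros box_cutoff_tendsto)
      show "AE x in lborel. norm (f x * box_cutoff a b n x) \<le> \<bar>f x\<bar>" for n
        using box_cutoff_bounds[of a b n] by (intro AE_I2) (simp add: abs_mult mult_left_le)
    qed (use f in auto)
    show "(\<lambda>n. LINT x|lborel. f x * box_cutoff a b n x) \<longlonglongrightarrow> 0"
      by (simp add: z box_cutoff_test_function that)
  qed
  have loc: "AE x in lborel. x \<in> box a b \<longrightarrow> f x = 0" if "cbox a b \<subseteq> U" for a b
  proof -
    have "AE x in lborel. f x * indicator (box a b) x = 0"
    proof (rule AE_zero_if_box_integrals_zero)
      show "integrable lborel (\<lambda>x. f x * indicator (box a b) x)"
        using f by (rule integrable_real_mult_indicator[rotated]) auto
      fix c d
      obtain a' b' where e: "box a b \<inter> box c d = box a' b'"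
        by (simp add: box_Int_box)
      have "(LINT x|lborel. f x * indicator (box a' b') x) = 0"
      \<comment> \<open>If the open box is empty, \<open>cbox a' b'\<close> can still be nonempty
        and leave \<open>U\<close>; only for a nonempty open box is it the closure and hence
        contained in \<open>cbox a b\<close>.\<close>
      proof (cases "box a' b' = {}")
        case False
        have "closure (box a' b') \<subseteq> cbox a b"
          using e box_subset_cbox[of a b] by (intro closure_minimal) auto
        then show ?thesis
          using box0[of a' b'] False that by simp
      qed simp
      then show "(LINT x|lborel. f x * indicator (box a b) x * indicator (box c d) x) = 0"
        by (simp add: e[symmetric] indicator_inter_arith mult.assoc)
    qed
    then show ?thesis by eventually_elim (auto simp: indicator_def split: if_splits)
  qed
  \<comment> \<open>The countable decomposition of \<open>U\<close> below consists of closed boxes,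
    so the null boundary of each box is added here.\<close>
  have loc': "AE x in lborel. x \<in> cbox a b \<longrightarrow> f x = 0" if "cbox a b \<subseteq> U" for a b
  proof -
    have "cbox a b - box a b \<in> null_sets lborel"
      using negligible_frontier_interval[of a b]
      by (simp add: negligible_iff_null_sets null_sets_completion_iff)
    then have "AE x in lborel. x \<notin> cbox a b - box a b"
      by (rule AE_not_in)
    with loc[OF that] show ?thesis by eventually_elim auto
  qed
  obtain \<D> where D: "countable \<D>" "\<D> \<subseteq> Pow U" "\<And>X. X \<in> \<D> \<Longrightarrow> \<exists>a b. X = cbox a b" "\<Union>\<D> = U"
    using open_countable_Union_open_cbox[OF U] by metis
  have "AE x in lborel. \<forall>X\<in>\<D>. x \<in> X \<longrightarrow> f x = 0"
    using D(1)
  proof (rule AE_ball_countable[THEN iffD2], intro ballI)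
    fix X assume "X \<in> \<D>"
    with D(2,3) loc' show "AE x in lborel. x \<in> X \<longrightarrow> f x = 0" by blast
  qed
  then show ?thesis by eventually_elim (use D(4) in auto)
qed

section \<open>Differences of a function with a weak gradient\<close>

lemma
  fixes f :: "'a::euclidean_space \<Rightarrow> 'b::{banach, second_countable_topology}"
  assumes [measurable]: "f \<in> borel_measurable borel"
  shows lborel_integral_translate: "(LINT x|lborel. f (x + c)) = (LINT x|lborel. f x)"
    and lborel_integrable_translate: "integrable lborel (\<lambda>x. f (x + c)) \<longleftrightarrow> integrable lborel f"
proof -
  have "(LINT x|distr lborel borel ((+) c). f x) = (LINT x|lborel. f (c + x))"
    by (rule integral_distr) auto
  then show "(LINT x|lborel. f (x + c)) = (LINT x|lborel. f x)"
    by (simp add: lborel_distr_plus add.commute)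
  have "integrable (distr lborel borel ((+) c)) f \<longleftrightarrow> integrable lborel (\<lambda>x. f (c + x))"
    by (rule integrable_distr_eq) auto
  then show "integrable lborel (\<lambda>x. f (x + c)) \<longleftrightarrow> integrable lborel f"
    by (simp add: lborel_distr_plus add.commute)
qed

lemma nn_integral_lborel_translate:
  fixes f :: "'a::euclidean_space \<Rightarrow> ennreal"
  assumes [measurable]: "f \<in> borel_measurable borel"
  shows "(\<integral>\<^sup>+x. f (x + c) \<partial>lborel) = (\<integral>\<^sup>+x. f x \<partial>lborel)"
proof -
  have "(\<integral>\<^sup>+x. f x \<partial>distr lborel borel ((+) c)) = (\<integral>\<^sup>+x. f (c + x) \<partial>lborel)"
    by (rule nn_integral_distr) auto
  then show ?thesis by (simp add: lborel_distr_plus add.commute)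
qed

section \<open>Test functions: derivatives, bounds, translation, integration along segments\<close>

lemma test_function_Ck: "\<phi> \<in> test_functions S \<Longrightarrow> Ck k \<phi>"
  by (simp add: test_functions_def)

lemma test_function_derivative:
  assumes "\<phi> \<in> test_functions S"
  shows "(\<phi> has_derivative (\<lambda>h. grad \<phi> x \<bullet> h)) (at x)"
proof -
  have "\<phi> differentiable (at x)"
    using test_function_Ck[OF assms, of "Suc 0"] by simp
  then have d: "(\<phi> has_derivative frechet_derivative \<phi> (at x)) (at x)"
    by (simp add: frechet_derivative_works)
  interpret bounded_linear "frechet_derivative \<phi> (at x)"
    using d by (rule has_derivative_bounded_linear)
  have "frechet_derivative \<phi> (at x) = (\<lambda>h. grad \<phi> x \<bullet> h)"
  proof
    fix h
    have "frechet_derivative \<phi> (at x) h = frechet_derivative \<phi> (at x) (\<Sum>i\<in>UNIV. (h $ i) *\<^sub>R axis i 1)"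
      by (simp only: basis_expansion[of h, unfolded scalar_mult_eq_scaleR])
    also have "\<dots> = (\<Sum>i\<in>UNIV. (h $ i) * grad \<phi> x $ i)"
      by (simp add: sum scaleR grad_def)
    finally show "frechet_derivative \<phi> (at x) h = grad \<phi> x \<bullet> h"
      by (simp add: inner_vec_def mult.commute)
  qed
  with d show ?thesis by simp
qed

lemma test_function_continuous: "\<phi> \<in> test_functions S \<Longrightarrow> continuous_on UNIV \<phi>"
  using test_function_Ck[of \<phi> S 0] by simp

lemma test_function_grad_continuous: "\<phi> \<in> test_functions S \<Longrightarrow> continuous_on UNIV (grad \<phi>)"
  using continuous_on_vec_lambda[of UNIV "\<lambda>i x. grad \<phi> x $ i"] test_function_Ck[of \<phi> S "Suc 0"]
  by simp

lemma test_function_eq_0: "\<phi> \<in> test_functions S \<Longrightarrow> x \<notin> S \<Longrightarrow> \<phi> x = 0"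
  using closure_subset[of "{x. \<phi> x \<noteq> 0}"] by (auto simp: test_functions_def)

lemma test_function_grad_eq_0:
  assumes "\<phi> \<in> test_functions S" "x \<notin> closure {x. \<phi> x \<noteq> 0}"
  shows "grad \<phi> x = 0"
proof -
  have "((\<lambda>_. 0) has_derivative (\<lambda>h. grad \<phi> x \<bullet> h)) (at x)"
    using test_function_derivative[OF assms(1), of x]
    by (rule has_derivative_transform_within_open[of _ _ _ _ "- closure {x. \<phi> x \<noteq> 0}"])
       (use assms(2) closure_subset[of "{x. \<phi> x \<noteq> 0}"] in auto)
  then have "(\<lambda>h. grad \<phi> x \<bullet> h) = (\<lambda>h. 0)"
    by (rule has_derivative_unique) simp
  then have "grad \<phi> x \<bullet> grad \<phi> x = 0" by metis
  then show ?thesis by simp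
qed

lemma compact_support_bounded:
  fixes f :: "'a::topological_space \<Rightarrow> 'b::real_normed_vector"
  assumes "continuous_on UNIV f" "compact K" "\<And>x. x \<notin> K \<Longrightarrow> f x = 0"
  obtains M where "0 \<le> M" "\<And>x. norm (f x) \<le> M"
proof -
  have "bounded (f ` K)"
    using assms by (intro compact_imp_bounded compact_continuous_image) (auto intro: continuous_on_subset)
  then obtain M where "\<And>x. x \<in> K \<Longrightarrow> norm (f x) \<le> M"
    by (auto simp: bounded_iff)
  then have "norm (f x) \<le> max 0 M" for x
    using assms(3)[of x] by (cases "x \<in> K") (auto simp: le_max_iff_disj)
  then show ?thesis using that[of "max 0 M"] by simp
qed

lemma test_function_bounded:
  assumes "\<phi> \<in> test_functions S"
  obtains M where "0 \<le> M" "\<And>x. \<bar>\<phi> x\<bar> \<le> M" "\<And>x. norm (grad \<phi> x) \<le> M"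
proof -
  have K: "compact (closure {x. \<phi> x \<noteq> 0})" using assms by (simp add: test_functions_def)
  have "\<phi> x = 0" if "x \<notin> closure {x. \<phi> x \<noteq> 0}" for x
    using that closure_subset[of "{x. \<phi> x \<noteq> 0}"] by auto
  then obtain M1 where 1: "0 \<le> M1" "\<And>x. norm (\<phi> x) \<le> M1"
    using compact_support_bounded[OF test_function_continuous[OF assms] K] by blast
  obtain M2 where 2: "0 \<le> M2" "\<And>x. norm (grad \<phi> x) \<le> M2"
    using compact_support_bounded[OF test_function_grad_continuous[OF assms] K test_function_grad_eq_0[OF assms]] by blast
  show ?thesis
    using that[of "max M1 M2"] 1 2 by (simp add: le_max_iff_disj)
qed

lemma grad_translate:
  fixes f :: "real^'n \<Rightarrow> real"
  assumes "f differentiable (at (x - c))"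
  shows "((\<lambda>x. f (x - c)) has_derivative frechet_derivative f (at (x - c))) (at x)"
    and "grad (\<lambda>x. f (x - c)) x = grad f (x - c)"
proof -
  have "(f has_derivative frechet_derivative f (at (x - c))) (at (x - c))"
    using assms by (simp add: frechet_derivative_works)
  moreover have "((\<lambda>x. x - c) has_derivative (\<lambda>h. h)) (at x)"
    by (auto intro!: derivative_eq_intros)
  ultimately show d: "((\<lambda>x. f (x - c)) has_derivative frechet_derivative f (at (x - c))) (at x)"
    by (rule has_derivative_compose[rotated])
  show "grad (\<lambda>x. f (x - c)) x = grad f (x - c)"
    by (simp add: vec_eq_iff grad_nth[OF d]) (simp add: grad_def)
qed

lemma Ck_translate: "Ck k f \<Longrightarrow> Ck k (\<lambda>x. f (x - c))"
proof (induction k arbitrary: f)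
  case 0
  then have "continuous_on UNIV (f \<circ> (\<lambda>x. x - c))"
    by (intro continuous_on_compose continuous_intros) (auto intro: continuous_on_subset)
  then show ?case by (simp add: o_def)
next
  case (Suc k)
  then have d: "f differentiable (at x)" for x by simp
  have "(\<lambda>x. f (x - c)) differentiable (at x)" for x
    using grad_translate(1)[OF d] by (auto simp: differentiable_def)
  moreover have "Ck k (\<lambda>x. grad (\<lambda>x. f (x - c)) x $ i)" for i
    using Suc.IH[of "\<lambda>x. grad f x $ i"] Suc.prems by (simp add: grad_translate(2)[OF d])
  ultimately show ?case by simp
qed

lemma test_function_translate:
  assumes "\<phi> \<in> test_functions U" and sub: "\<And>x. x \<in> U \<Longrightarrow> x + c \<in> S"
  shows "(\<lambda>x. \<phi> (x - c)) \<in> test_functions S"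
proof -
  have "x \<in> (+) c ` {x. \<phi> x \<noteq> 0} \<longleftrightarrow> \<phi> (x - c) \<noteq> 0" for x
    by (auto simp: image_iff intro!: exI[of _ "x - c"])
  then have "{x. \<phi> (x - c) \<noteq> 0} = (+) c ` {x. \<phi> x \<noteq> 0}"
    by blast
  then have "closure {x. \<phi> (x - c) \<noteq> 0} = (+) c ` closure {x. \<phi> x \<noteq> 0}"
    by (simp add: closure_translation)
  moreover have "compact (closure {x. \<phi> x \<noteq> 0})" "closure {x. \<phi> x \<noteq> 0} \<subseteq> U"
    using assms(1) by (auto simp: test_functions_def)
  ultimately show ?thesis
    using sub compact_translation[of "closure {x. \<phi> x \<noteq> 0}" c] Ck_translate[OF test_function_Ck[OF assms(1)]]
    by (simp add: test_functions_def del: compact_closure) (force simp: add.commute)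
qed

lemma test_function_FTC:
  assumes "\<phi> \<in> test_functions S"
  shows "(LINT t|lborel. (grad \<phi> (x + t *\<^sub>R h) \<bullet> h) * indicator {0..1} t) = \<phi> (x + h) - \<phi> x"
proof -
  have "((\<lambda>t. \<phi> (x + t *\<^sub>R h)) has_real_derivative (grad \<phi> (x + t *\<^sub>R h) \<bullet> h)) (at t)" for t
  proof -
    have "((\<lambda>t. x + t *\<^sub>R h) has_derivative (\<lambda>s. s *\<^sub>R h)) (at t)"
      by (auto intro!: derivative_eq_intros)
    from has_derivative_compose[OF this test_function_derivative[OF assms]]
    moreover have "(\<lambda>s. grad \<phi> (x + t *\<^sub>R h) \<bullet> (s *\<^sub>R h)) = (*) (grad \<phi> (x + t *\<^sub>R h) \<bullet> h)"
      by (auto simp: mult.commute)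
    ultimately show ?thesis by (simp only: has_field_derivative_def)
  qed
  moreover have "isCont (\<lambda>t. grad \<phi> (x + t *\<^sub>R h) \<bullet> h) t" for t
  proof -
    have "isCont (grad \<phi>) y" for y
      using test_function_grad_continuous[OF assms] by (simp add: continuous_on_eq_continuous_at)
    moreover have "isCont (\<lambda>t. x + t *\<^sub>R h) t"
      by (intro continuous_intros)
    ultimately have "isCont (\<lambda>t. grad \<phi> (x + t *\<^sub>R h)) t"
      by (intro isCont_o2[where f = "\<lambda>t. x + t *\<^sub>R h" and g = "grad \<phi>"])
    then show ?thesis by (intro continuous_inner continuous_const)
  qed
  ultimately have "(LINT t|lborel. (grad \<phi> (x + t *\<^sub>R h) \<bullet> h) * indicator {0..1} t)
      = \<phi> (x + 1 *\<^sub>R h) - \<phi> (x + 0 *\<^sub>R h)"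
    by (intro integral_FTC_Icc_real) auto
  then show ?thesis by simp
qed

text \<open>The complement consists of the differences of the closed set \<open>- S\<close> and the
  compact segment from 0 to \<open>h\<close>, and such a set of differences is closed.\<close>

lemma open_segment_domain:
  fixes S :: "'a::real_normed_vector set"
  assumes "open S"
  shows "open {x. \<forall>t\<in>{0..1::real}. x + t *\<^sub>R h \<in> S}"
proof -
  have "closed (\<Union>x\<in>- S. \<Union>y\<in>(\<lambda>t. t *\<^sub>R h) ` {0..1::real}. {x - y})"
    using assms by (intro closed_compact_differences compact_continuous_image continuous_intros) auto
  moreover have *: "x \<in> (\<Union>x\<in>- S. \<Union>y\<in>(\<lambda>t. t *\<^sub>R h) ` {0..1}. {x - y}) \<longleftrightarrow>
      (\<exists>t\<in>{0..1}. x + t *\<^sub>R h \<notin> S)" for x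
  proof
    assume "x \<in> (\<Union>x\<in>- S. \<Union>y\<in>(\<lambda>t. t *\<^sub>R h) ` {0..1}. {x - y})"
    then obtain y t where "y \<notin> S" "t \<in> {0..1}" "x = y - t *\<^sub>R h" by blast
    then show "\<exists>t\<in>{0..1}. x + t *\<^sub>R h \<notin> S" by (intro bexI[of _ t]) auto
  next
    assume "\<exists>t\<in>{0..1}. x + t *\<^sub>R h \<notin> S"
    then obtain t where t: "t \<in> {0..1}" "x + t *\<^sub>R h \<in> - S" by blast
    have "x \<in> {(x + t *\<^sub>R h) - t *\<^sub>R h}" by simp
    with t show "x \<in> (\<Union>x\<in>- S. \<Union>y\<in>(\<lambda>t. t *\<^sub>R h) ` {0..1}. {x - y})" by blast
  qed
  have "{x. \<forall>t\<in>{0..1}. x + t *\<^sub>R h \<in> S} = - (\<Union>x\<in>- S. \<Union>y\<in>(\<lambda>t. t *\<^sub>R h) ` {0..1}. {x - y})"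
    by (rule set_eqI) (simp only: Compl_iff * mem_Collect_eq, blast)
  ultimately show ?thesis by (simp add: open_closed)
qed

text \<open>Justifies exchanging the integrals over \<open>t\<close> and \<open>x\<close> on the
  side of \<open>u\<close> in the difference formula, where \<open>k\<close> is a directional
  derivative of a test function.\<close>

lemma integrable_strip:
  fixes u :: "real^'n \<Rightarrow> real"
  assumes u: "integrable lborel u"
    and [measurable]: "k \<in> borel_measurable (lborel \<Otimes>\<^sub>M lborel)"
    and k: "\<And>p. \<bar>k p\<bar> \<le> M"
  shows "integrable (lborel \<Otimes>\<^sub>M lborel) (\<lambda>(t::real, x). indicator {0..1} t * (u x * k (t, x)))"
proof (rule Bochner_Integration.integrable_bound)
  have [measurable]: "u \<in> borel_measurable borel"
    using borel_measurable_integrable[OF u] by simp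
  show "integrable (lborel \<Otimes>\<^sub>M lborel) (\<lambda>(t::real, x). indicator {0..1} t * (\<bar>u x\<bar> * M))"
  proof (rule lborel_pair.Fubini_integrable)
    show "integrable lborel (\<lambda>t::real. LINT x|lborel. norm (case (t, x) of (t, x) \<Rightarrow> indicator {0..1} t * (\<bar>u x\<bar> * M)))"
    proof -
      have "(LINT x|lborel. norm (indicator {0..1} t * (\<bar>u x\<bar> * M))) = indicator {0..1} t * (LINT x|lborel. \<bar>u x\<bar> * \<bar>M\<bar>)" for t :: real
        by (simp add: abs_mult)
      then show ?thesis by simp
    qed
    show "AE t in lborel. integrable lborel (\<lambda>x. case (t, x) of (t::real, x) \<Rightarrow> indicator {0..1} t * (\<bar>u x\<bar> * M))"
      using u by (intro AE_I2) auto
  qed measurable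
  show "(\<lambda>(t::real, x). indicator {0..1} t * (u x * k (t, x))) \<in> borel_measurable (lborel \<Otimes>\<^sub>M lborel)"
    by measurable
  have "\<bar>u x * k (t, x)\<bar> \<le> \<bar>\<bar>u x\<bar> * M\<bar>" for t x
    using k[of "(t, x)"] by (simp add: abs_mult mult_left_mono)
  then show "AE p in lborel \<Otimes>\<^sub>M lborel. norm (case p of (t::real, x) \<Rightarrow> indicator {0..1} t * (u x * k (t, x)))
      \<le> norm (case p of (t::real, x) \<Rightarrow> indicator {0..1} t * (\<bar>u x\<bar> * M))"
    by (intro AE_I2) (auto simp: abs_mult indicator_def)
qed

text \<open>The counterpart for the gradient side. By translation invariance the inner integral of
  \<open>\<bar>w\<bar>\<close> does not depend on \<open>t\<close>, so the criterion of Fubini's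
  theorem holds for every integrable \<open>w\<close>.\<close>

lemma integrable_shifted_strip:
  fixes w :: "real^'n \<Rightarrow> real"
  assumes w: "integrable lborel w"
  shows "integrable (lborel \<Otimes>\<^sub>M lborel) (\<lambda>(t::real, x). indicator {0..1} t * w (x + t *\<^sub>R h))"
proof (rule lborel_pair.Fubini_integrable)
  have [measurable]: "w \<in> borel_measurable borel"
    using borel_measurable_integrable[OF w] by simp
  show "(\<lambda>(t::real, x). indicator {0..1} t * w (x + t *\<^sub>R h)) \<in> borel_measurable (lborel \<Otimes>\<^sub>M lborel)"
    by measurable
  have "(LINT x|lborel. norm (indicator {0..1} t * w (x + t *\<^sub>R h))) = indicator {0..1} t * (LINT x|lborel. \<bar>w x\<bar>)" for t :: real
    using lborel_integral_translate[of "\<lambda>x. \<bar>w x\<bar>" "t *\<^sub>R h"] by (simp add: abs_mult)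
  then show "integrable lborel (\<lambda>t::real. LINT x|lborel. norm (case (t, x) of (t, x) \<Rightarrow> indicator {0..1} t * w (x + t *\<^sub>R h)))"
    by simp
  show "AE t in lborel. integrable lborel (\<lambda>x. case (t, x) of (t::real, x) \<Rightarrow> indicator {0..1} t * w (x + t *\<^sub>R h))"
    using w by (intro AE_I2) (auto simp: lborel_integrable_translate)
qed

text \<open>The functions are integrable on the whole space, so that translations and Fubini's
  theorem for \<open>lborel\<close> apply directly; the set \<open>S\<close> enters only through the
  supports of the test functions.\<close>

definition integrable_weak_gradient ::
    "(real^'n) set \<Rightarrow> (real^'n \<Rightarrow> real) \<Rightarrow> (real^'n \<Rightarrow> real^'n) \<Rightarrow> bool" where
  "integrable_weak_gradient S u g \<longleftrightarrow> integrable lborel u \<and> integrable lborel g \<and>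
     (\<forall>\<phi>\<in>test_functions S. \<forall>i.
        (LINT x|lborel. u x * grad \<phi> x $ i) = - (LINT x|lborel. g x $ i * \<phi> x))"

lemma integrable_mult_bounded:
  fixes u k :: "'a \<Rightarrow> real"
  assumes "integrable M u" "k \<in> borel_measurable M" "\<And>x. \<bar>k x\<bar> \<le> C"
  shows "integrable M (\<lambda>x. u x * k x)"
proof (rule Bochner_Integration.integrable_bound)
  show "integrable M (\<lambda>x. u x * C)" using assms by simp
  show "(\<lambda>x. u x * k x) \<in> borel_measurable M" using assms by measurable
  have "\<bar>u x * k x\<bar> \<le> \<bar>u x * C\<bar>" for x
    using assms(3)[of x] by (simp add: abs_mult mult_left_mono)
  then show "AE x in M. norm (u x * k x) \<le> norm (u x * C)" by simp
qed

lemma integrable_weak_gradient_inner: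
  assumes w: "integrable_weak_gradient S u g" and \<phi>: "\<phi> \<in> test_functions S"
  shows "(LINT x|lborel. u x * (grad \<phi> x \<bullet> h)) = - (LINT x|lborel. (g x \<bullet> h) * \<phi> x)"
proof -
  obtain M where M: "\<And>x. \<bar>\<phi> x\<bar> \<le> M" "\<And>x. norm (grad \<phi> x) \<le> M"
    using test_function_bounded[OF \<phi>] by metis
  have [measurable]: "\<phi> \<in> borel_measurable borel" "grad \<phi> \<in> borel_measurable borel"
    using test_function_continuous[OF \<phi>] test_function_grad_continuous[OF \<phi>]
    by (auto intro: borel_measurable_continuous_onI)
  have u: "integrable lborel u" and g: "integrable lborel g"
    using w by (auto simp: integrable_weak_gradient_def)
  have gi: "integrable lborel (\<lambda>x. g x $ i)" for i
    using integrable_bounded_linear[OF bounded_linear_vec_nth g] .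
  have "integrable lborel (\<lambda>x. u x * grad \<phi> x $ i)" for i
  proof (rule integrable_mult_bounded[OF u])
    show "(\<lambda>x. grad \<phi> x $ i) \<in> borel_measurable lborel"
      using test_function_grad_continuous[OF \<phi>]
      by (auto intro!: borel_measurable_continuous_onI continuous_on_component)
    show "\<bar>grad \<phi> x $ i\<bar> \<le> M" for x
      using component_le_norm_cart[of "grad \<phi> x" i] M(2)[of x] by linarith
  qed
  then have "(LINT x|lborel. u x * (grad \<phi> x \<bullet> h)) = (\<Sum>i\<in>UNIV. (LINT x|lborel. u x * grad \<phi> x $ i) * h $ i)"
    by (simp add: inner_vec_def sum_distrib_left mult.assoc[symmetric])
  also have "\<dots> = - (\<Sum>i\<in>UNIV. (LINT x|lborel. g x $ i * \<phi> x) * h $ i)"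
    using w \<phi> by (simp add: integrable_weak_gradient_def sum_negf)
  also have "(\<Sum>i\<in>UNIV. (LINT x|lborel. g x $ i * \<phi> x) * h $ i) = (LINT x|lborel. (g x \<bullet> h) * \<phi> x)"
    using integrable_mult_bounded[OF gi _ M(1)]
    by (simp add: inner_vec_def sum_distrib_right mult.assoc mult.commute[of "h $ _"])
       (simp add: mult.assoc[symmetric])
  finally show ?thesis .
qed

text \<open>Test against \<open>\<phi>\<close> translated by \<open>-t h\<close> and integrate over \<open>t \<in> [0, 1]\<close>; the fundamental
  theorem of calculus for \<open>\<phi>\<close> turns the left-hand side into a difference of \<open>u\<close>.\<close>

lemma weak_gradient_difference:
  fixes u :: "real^'n \<Rightarrow> real"
  assumes w: "integrable_weak_gradient S u g" and S: "open S"
  shows "AE x in lborel. (\<forall>t\<in>{0..1::real}. x + t *\<^sub>R h \<in> S) \<longrightarrow>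
    u (x + h) - u x = (LINT t|lborel. indicator {0..1} t * (g (x + t *\<^sub>R h) \<bullet> h))"
proof -
  define U where "U = {x. \<forall>t\<in>{0..1::real}. x + t *\<^sub>R h \<in> S}"
  define G where "G x = (LINT t|lborel. indicator {0..1} t * (g (x + t *\<^sub>R h) \<bullet> h))" for x
  have u: "integrable lborel u" and g: "integrable lborel g"
    using w by (auto simp: integrable_weak_gradient_def)
  have [measurable]: "u \<in> borel_measurable borel" "g \<in> borel_measurable borel"
    using borel_measurable_integrable[OF u] borel_measurable_integrable[OF g] by auto
  have gh: "integrable lborel (\<lambda>x. g x \<bullet> h)"
    using g by simp
  have strip: "integrable (lborel \<Otimes>\<^sub>M lborel) (\<lambda>(t::real, x). indicator {0..1} t * (g (x + t *\<^sub>R h) \<bullet> h))"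
    using integrable_shifted_strip[OF gh] by simp
  have G: "integrable lborel G"
    using lborel_pair.integrable_snd[OF strip] by (simp add: G_def[abs_def])
  have uh: "integrable lborel (\<lambda>x. u (x + h))"
    using u by (simp add: lborel_integrable_translate)
  have "AE x in lborel. x \<in> U \<longrightarrow> u (x + h) - u x - G x = 0"
  proof (rule fundamental_lemma_variations)
    show "integrable lborel (\<lambda>x. u (x + h) - u x - G x)"
      using u uh G by simp
    show "open U"
      unfolding U_def by (rule open_segment_domain[OF S])
    fix \<phi> assume \<phi>: "\<phi> \<in> test_functions U"
    obtain M where M: "\<And>x. \<bar>\<phi> x\<bar> \<le> M" "\<And>x. norm (grad \<phi> x) \<le> M"
      using test_function_bounded[OF \<phi>] by metis
    have [measurable]: "\<phi> \<in> borel_measurable borel" "grad \<phi> \<in> borel_measurable borel"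
      using test_function_continuous[OF \<phi>] test_function_grad_continuous[OF \<phi>]
      by (auto intro: borel_measurable_continuous_onI)
    have diff: "\<phi> differentiable (at x)" for x
      using test_function_Ck[OF \<phi>, of "Suc 0"] by simp
    have bound: "\<bar>grad \<phi> x \<bullet> h\<bar> \<le> M * norm h" for x
      using Cauchy_Schwarz_ineq2[of "grad \<phi> x" h] mult_right_mono[OF M(2)[of x], of "norm h"] by simp
    have u\<phi>: "integrable lborel (\<lambda>x. u x * \<phi> x)"
      using u M by (intro integrable_mult_bounded) auto
    have u\<phi>h: "integrable lborel (\<lambda>x. u x * \<phi> (x - h))"
      using u M by (intro integrable_mult_bounded) auto
    \<comment> \<open>Every point of the support of \<phi> carries its whole segment inside
      \<open>S\<close>, so the translate of \<phi> is a test function of \<open>S\<close> and the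
      weak gradient identity applies to it.\<close>
    have tested: "(LINT x|lborel. u x * (grad \<phi> (x - t *\<^sub>R h) \<bullet> h))
        = - (LINT x|lborel. (g (x + t *\<^sub>R h) \<bullet> h) * \<phi> x)" if t: "t \<in> {0..1}" for t
    proof -
      have "(\<lambda>x. \<phi> (x - t *\<^sub>R h)) \<in> test_functions S"
        using t by (intro test_function_translate[OF \<phi>]) (auto simp: U_def)
      from integrable_weak_gradient_inner[OF w this, of h]
      have "(LINT x|lborel. u x * (grad \<phi> (x - t *\<^sub>R h) \<bullet> h)) = - (LINT x|lborel. (g x \<bullet> h) * \<phi> (x - t *\<^sub>R h))"
        by (simp add: grad_translate(2)[OF diff])
      also have "(LINT x|lborel. (g x \<bullet> h) * \<phi> (x - t *\<^sub>R h)) = (LINT x|lborel. (g (x + t *\<^sub>R h) \<bullet> h) * \<phi> x)"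
        using lborel_integral_translate[of "\<lambda>x. (g x \<bullet> h) * \<phi> (x - t *\<^sub>R h)" "t *\<^sub>R h"] by simp
      finally show ?thesis .
    qed
    \<comment> \<open>The segment runs backwards, from \<open>x\<close> to \<open>x - h\<close>,
      which is why the fundamental theorem is applied with \<open>- h\<close>.\<close>
    have FTC: "(LINT t|lborel. indicator {0..1} t * (u x * (grad \<phi> (x - t *\<^sub>R h) \<bullet> h))) = u x * \<phi> x - u x * \<phi> (x - h)" for x
    proof -
      have "(LINT t|lborel. indicator {0..1} t * (u x * (grad \<phi> (x - t *\<^sub>R h) \<bullet> h)))
          = - u x * (LINT t|lborel. (grad \<phi> (x + t *\<^sub>R (- h)) \<bullet> (- h)) * indicator {0..1} t)"
        unfolding integral_mult_right_zero[symmetric]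
        by (intro Bochner_Integration.integral_cong) auto
      then show ?thesis
        unfolding test_function_FTC[OF \<phi>] by (simp add: algebra_simps)
    qed
    have "(LINT x|lborel. u x * \<phi> x) - (LINT x|lborel. u x * \<phi> (x - h))
        = (LINT x|lborel. LINT t|lborel. indicator {0..1} t * (u x * (grad \<phi> (x - t *\<^sub>R h) \<bullet> h)))"
      using u\<phi> u\<phi>h by (simp add: FTC)
    also have "\<dots> = (LINT t|lborel. LINT x|lborel. indicator {0..1} t * (u x * (grad \<phi> (x - t *\<^sub>R h) \<bullet> h)))"
    proof (rule lborel_pair.Fubini_integral)
      show "integrable (lborel \<Otimes>\<^sub>M lborel) (\<lambda>(t::real, x). indicator {0..1} t * (u x * (grad \<phi> (x - t *\<^sub>R h) \<bullet> h)))"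
        using integrable_strip[OF u, of "\<lambda>(t, x). grad \<phi> (x - t *\<^sub>R h) \<bullet> h" "M * norm h"] bound by auto
    qed
    also have "\<dots> = (LINT t|lborel. LINT x|lborel. - (indicator {0..1} t * ((g (x + t *\<^sub>R h) \<bullet> h) * \<phi> x)))"
    proof (rule Bochner_Integration.integral_cong[OF refl])
      show "(LINT x|lborel. indicator {0..1} t * (u x * (grad \<phi> (x - t *\<^sub>R h) \<bullet> h)))
          = (LINT x|lborel. - (indicator {0..1} t * ((g (x + t *\<^sub>R h) \<bullet> h) * \<phi> x)))" for t
        using tested[of t] by (cases "t \<in> {0..1}") simp_all
    qed
    also have "\<dots> = (LINT x|lborel. LINT t|lborel. - (indicator {0..1} t * ((g (x + t *\<^sub>R h) \<bullet> h) * \<phi> x)))"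
    proof (rule lborel_pair.Fubini_integral[symmetric])
      have "integrable (lborel \<Otimes>\<^sub>M lborel) (\<lambda>p. (case p of (t::real, x) \<Rightarrow> indicator {0..1} t * (g (x + t *\<^sub>R h) \<bullet> h)) * - \<phi> (snd p))"
        using M by (intro integrable_mult_bounded[OF strip]) auto
      then show "integrable (lborel \<Otimes>\<^sub>M lborel) (\<lambda>(t::real, x). - (indicator {0..1} t * ((g (x + t *\<^sub>R h) \<bullet> h) * \<phi> x)))"
        by (simp add: case_prod_unfold mult.assoc)
    qed
    also have "\<dots> = - (LINT x|lborel. G x * \<phi> x)"
      by (simp add: G_def mult.assoc[symmetric])
    finally have eq: "(LINT x|lborel. u x * \<phi> x) - (LINT x|lborel. u x * \<phi> (x - h)) = - (LINT x|lborel. G x * \<phi> x)" .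
    have "(LINT x|lborel. u x * \<phi> (x - h)) = (LINT x|lborel. u (x + h) * \<phi> x)"
      using lborel_integral_translate[of "\<lambda>x. u x * \<phi> (x - h)" h] by simp
    moreover have "integrable lborel (\<lambda>x. u (x + h) * \<phi> x)" "integrable lborel (\<lambda>x. G x * \<phi> x)"
      using uh G M by (auto intro!: integrable_mult_bounded)
    ultimately show "(LINT x|lborel. (u (x + h) - u x - G x) * \<phi> x) = 0"
      using eq u\<phi> by (simp add: left_diff_distrib)
  qed
  then show ?thesis by eventually_elim (auto simp: U_def G_def)
qed

section \<open>The Poincare inequality on Lipschitz domains\<close>

text \<open>The substitution contributes the factor 1/c to the power of the dimension, and 1/c is at
  most 2.\<close>

lemma nn_integral_lborel_affine_le:
  fixes \<gamma> :: "'a::euclidean_space \<Rightarrow> ennreal"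
  assumes [measurable]: "\<gamma> \<in> borel_measurable borel" and c: "c \<ge> 1 / 2"
  shows "(\<integral>\<^sup>+x. \<gamma> (b + c *\<^sub>R x) \<partial>lborel) \<le> 2 ^ DIM('a) * (\<integral>\<^sup>+x. \<gamma> x \<partial>lborel)"
proof -
  define X where "X = (\<integral>\<^sup>+x. \<gamma> (b + c *\<^sub>R x) \<partial>lborel)"
  have "(\<integral>\<^sup>+x. \<gamma> x \<partial>lborel) = (\<integral>\<^sup>+x. \<gamma> x \<partial>density (distr lborel borel (\<lambda>x. b + c *\<^sub>R x)) (\<lambda>_. ennreal (\<bar>c\<bar> ^ DIM('a))))"
    using lborel_affine[of c b] c by simp
  also have "\<dots> = ennreal (\<bar>c\<bar> ^ DIM('a)) * X"
    by (simp add: nn_integral_density nn_integral_distr nn_integral_cmult X_def)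
  finally have eq: "(\<integral>\<^sup>+x. \<gamma> x \<partial>lborel) = ennreal (\<bar>c\<bar> ^ DIM('a)) * X" .
  have "1 \<le> (2 * \<bar>c\<bar>) ^ DIM('a)"
    using c by (intro one_le_power) auto
  then have "1 * X \<le> ennreal (2 ^ DIM('a) * \<bar>c\<bar> ^ DIM('a)) * X"
    by (intro mult_right_mono) (auto simp: power_mult_distrib simp flip: ennreal_1 intro: ennreal_leI)
  also have "\<dots> = 2 ^ DIM('a) * (\<integral>\<^sup>+x. \<gamma> x \<partial>lborel)"
    unfolding eq by (simp add: ennreal_mult mult.assoc ennreal_power[symmetric])
  finally show ?thesis by (simp add: X_def)
qed

text \<open>Cauchy-Schwarz against the indicator of \<open>{0..1}\<close>, a set of measure one. If
  the integrand is not integrable, the Bochner integral is 0 by convention and the bound is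
  trivial.\<close>

lemma square_integral_unit_interval_le:
  fixes f :: "real \<Rightarrow> real"
  assumes [measurable]: "f \<in> borel_measurable borel"
  shows "ennreal ((LINT t|lborel. indicator {0..1} t * f t)\<^sup>2)
    \<le> (\<integral>\<^sup>+t. indicator {0..1} t * ennreal ((f t)\<^sup>2) \<partial>lborel)"
proof (cases "integrable lborel (\<lambda>t. indicator {0..1} t * f t)")
  case True
  have "ennreal ((LINT t|lborel. indicator {0..1} t * f t)\<^sup>2)
      = (ennreal (norm (LINT t|lborel. indicator {0..1} t * f t)))\<^sup>2"
    by (simp add: ennreal_power)
  also have "\<dots> \<le> (\<integral>\<^sup>+t. ennreal (norm (indicator {0..1} t * f t)) \<partial>lborel)\<^sup>2"
    by (intro power_mono integral_norm_bound_ennreal True) simp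
  also have "\<dots> = (\<integral>\<^sup>+t. ennreal (norm (indicator {0..1} t * f t)) * indicator {0..1} t \<partial>lborel)\<^sup>2"
    by (intro arg_cong[where f = "\<lambda>x. x\<^sup>2"] nn_integral_cong) (auto simp: indicator_def)
  also have "\<dots> \<le> (\<integral>\<^sup>+t. (ennreal (norm (indicator {0..1} t * f t)))\<^sup>2 \<partial>lborel) * (\<integral>\<^sup>+t. (indicator {0..1::real} t)\<^sup>2 \<partial>lborel)"
    by (rule Cauchy_Schwarz_nn_integral) measurable
  also have "(\<integral>\<^sup>+t. (ennreal (norm (indicator {0..1} t * f t)))\<^sup>2 \<partial>lborel) = (\<integral>\<^sup>+t. indicator {0..1} t * ennreal ((f t)\<^sup>2) \<partial>lborel)"
    by (intro nn_integral_cong) (auto simp: indicator_def ennreal_power)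
  also have "(\<integral>\<^sup>+t. (indicator {0..1::real} t)\<^sup>2 \<partial>lborel) = (\<integral>\<^sup>+t. indicator {0..1::real} t \<partial>lborel)"
    by (intro nn_integral_cong) (auto simp: indicator_def)
  finally show ?thesis by simp
qed (simp add: not_integrable_integral_eq)

text \<open>An unnormalised mean square difference between the values on \<open>A\<close> and those
  on \<open>B\<close>. With values in \<open>ennreal\<close> it can be manipulated by Tonelli's
  theorem without integrability conditions.\<close>

definition gap :: "('a::euclidean_space \<Rightarrow> real) \<Rightarrow> 'a set \<Rightarrow> 'a set \<Rightarrow> ennreal" where
  "gap u A B = (\<integral>\<^sup>+x. \<integral>\<^sup>+y. indicator A x * indicator B y * ennreal ((u x - u y)\<^sup>2) \<partial>lborel \<partial>lborel)"

lemma gap_sym: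
  assumes [measurable]: "u \<in> borel_measurable borel" "A \<in> sets borel" "B \<in> sets borel"
  shows "gap u A B = gap u B A"
  unfolding gap_def
  by (subst lborel_pair.Fubini') (auto intro!: nn_integral_cong simp: power2_commute mult_ac)

lemma gap_mono: "A \<subseteq> A' \<Longrightarrow> B \<subseteq> B' \<Longrightarrow> gap u A B \<le> gap u A' B'"
  unfolding gap_def by (intro nn_integral_mono mult_mono) (auto simp: indicator_def)

lemma gap_Un_le:
  assumes [measurable]: "u \<in> borel_measurable borel" "A \<in> sets borel" "A' \<in> sets borel" "B \<in> sets borel"
  shows "gap u (A \<union> A') B \<le> gap u A B + gap u A' B"
proof -
  have "gap u (A \<union> A') B \<le> (\<integral>\<^sup>+x. \<integral>\<^sup>+y. indicator A x * indicator B y * ennreal ((u x - u y)\<^sup>2)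
      + indicator A' x * indicator B y * ennreal ((u x - u y)\<^sup>2) \<partial>lborel \<partial>lborel)"
    unfolding gap_def by (intro nn_integral_mono) (auto simp: indicator_def)
  then show ?thesis by (simp add: gap_def nn_integral_add)
qed

text \<open>Integrate (u x - u y)^2 \<le> 2 ((u x - u z)^2 + (u z - u y)^2) over x in A, z in B and
  y in C. Each of the three terms leaves one variable free, which contributes the measure of its
  set.\<close>

lemma gap_trans:
  assumes [measurable]: "u \<in> borel_measurable borel" "A \<in> sets borel" "B \<in> sets borel" "C \<in> sets borel"
  shows "emeasure lborel B * gap u A C \<le> 2 * (emeasure lborel C * gap u A B + emeasure lborel A * gap u B C)"
proof -
  let ?d = "\<lambda>x y. ennreal ((u x - u y)\<^sup>2)"
  have "emeasure lborel B * gap u A C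
      = (\<integral>\<^sup>+z. (\<integral>\<^sup>+x. \<integral>\<^sup>+y. indicator B z * (indicator A x * indicator C y * ?d x y) \<partial>lborel \<partial>lborel) \<partial>lborel)"
    by (simp add: gap_def nn_integral_cmult nn_integral_multc)
  also have "\<dots> \<le> (\<integral>\<^sup>+z. (\<integral>\<^sup>+x. \<integral>\<^sup>+y. 2 * (indicator C y * (indicator A x * indicator B z * ?d x z)
      + indicator A x * (indicator B z * indicator C y * ?d z y)) \<partial>lborel \<partial>lborel) \<partial>lborel)"
  proof (intro nn_integral_mono)
    fix x y z
    have "(u x - u y)\<^sup>2 \<le> 2 * ((u x - u z)\<^sup>2 + (u z - u y)\<^sup>2)"
      using zero_le_power2[of "(u x - u z) - (u z - u y)"] by (simp add: power2_eq_square algebra_simps)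
    then have "?d x y \<le> 2 * (?d x z + ?d z y)"
      by (simp add: ennreal_leI ennreal_plus[symmetric] ennreal_mult[symmetric] del: ennreal_plus flip: ennreal_numeral)
    then show "indicator B z * (indicator A x * indicator C y * ?d x y) \<le> 2 * (indicator C y * (indicator A x * indicator B z * ?d x z)
      + indicator A x * (indicator B z * indicator C y * ?d z y))"
      by (auto simp: indicator_def)
  qed
  also have "\<dots> = 2 * ((\<integral>\<^sup>+z. \<integral>\<^sup>+x. \<integral>\<^sup>+y. indicator C y * (indicator A x * indicator B z * ?d x z) \<partial>lborel \<partial>lborel \<partial>lborel)
      + (\<integral>\<^sup>+z. \<integral>\<^sup>+x. \<integral>\<^sup>+y. indicator A x * (indicator B z * indicator C y * ?d z y) \<partial>lborel \<partial>lborel \<partial>lborel))"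
    by (simp add: nn_integral_cmult nn_integral_add)
  also have "(\<integral>\<^sup>+z. \<integral>\<^sup>+x. \<integral>\<^sup>+y. indicator C y * (indicator A x * indicator B z * ?d x z) \<partial>lborel \<partial>lborel \<partial>lborel)
      = (\<integral>\<^sup>+z. \<integral>\<^sup>+x. emeasure lborel C * (indicator A x * indicator B z * ?d x z) \<partial>lborel \<partial>lborel)"
    by (simp add: nn_integral_multc)
  also have "\<dots> = emeasure lborel C * gap u A B"
    by (subst lborel_pair.Fubini') (simp_all add: nn_integral_cmult gap_def)
  also have "(\<integral>\<^sup>+z. \<integral>\<^sup>+x. \<integral>\<^sup>+y. indicator A x * (indicator B z * indicator C y * ?d z y) \<partial>lborel \<partial>lborel \<partial>lborel)
      = emeasure lborel A * gap u B C"
    by (simp add: nn_integral_cmult nn_integral_multc gap_def)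
  finally show ?thesis .
qed

text \<open>The variable of substitution is \<open>y\<close> when t \<ge> 1/2 and \<open>x\<close>
  otherwise. Its coefficient is then always at least 1/2, so the bound is uniform in
  \<open>t\<close> although either substitution alone degenerates at one end of the segment.\<close>

lemma segment_average_le:
  fixes \<gamma> :: "'a::euclidean_space \<Rightarrow> ennreal"
  assumes [measurable]: "\<gamma> \<in> borel_measurable borel" "A \<in> sets borel" "B \<in> sets borel"
  shows "(\<integral>\<^sup>+x. \<integral>\<^sup>+y. indicator A x * indicator B y * \<gamma> (x + t *\<^sub>R (y - x)) \<partial>lborel \<partial>lborel)
    \<le> 2 ^ DIM('a) * (emeasure lborel A + emeasure lborel B) * (\<integral>\<^sup>+x. \<gamma> x \<partial>lborel)"
proof (cases "t \<ge> 1 / 2")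
  case True
  have "(\<integral>\<^sup>+x. \<integral>\<^sup>+y. indicator A x * indicator B y * \<gamma> (x + t *\<^sub>R (y - x)) \<partial>lborel \<partial>lborel)
      \<le> (\<integral>\<^sup>+x. indicator A x * (\<integral>\<^sup>+y. \<gamma> ((1 - t) *\<^sub>R x + t *\<^sub>R y) \<partial>lborel) \<partial>lborel)"
    by (subst nn_integral_cmult[symmetric], measurable)
       (auto intro!: nn_integral_mono simp: indicator_def algebra_simps)
  also have "\<dots> \<le> (\<integral>\<^sup>+x. indicator A x * (2 ^ DIM('a) * (\<integral>\<^sup>+x. \<gamma> x \<partial>lborel)) \<partial>lborel)"
    using True by (intro nn_integral_mono mult_left_mono nn_integral_lborel_affine_le) auto
  also have "\<dots> = emeasure lborel A * (2 ^ DIM('a) * (\<integral>\<^sup>+x. \<gamma> x \<partial>lborel))"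
    by (simp add: nn_integral_multc)
  also have "\<dots> \<le> (emeasure lborel A + emeasure lborel B) * (2 ^ DIM('a) * (\<integral>\<^sup>+x. \<gamma> x \<partial>lborel))"
    by (intro mult_right_mono) auto
  finally show ?thesis by (simp add: mult_ac)
next
  case False
  have "(\<integral>\<^sup>+x. \<integral>\<^sup>+y. indicator A x * indicator B y * \<gamma> (x + t *\<^sub>R (y - x)) \<partial>lborel \<partial>lborel)
      = (\<integral>\<^sup>+y. \<integral>\<^sup>+x. indicator A x * indicator B y * \<gamma> (x + t *\<^sub>R (y - x)) \<partial>lborel \<partial>lborel)"
    by (rule lborel_pair.Fubini') measurable
  also have "\<dots> \<le> (\<integral>\<^sup>+y. indicator B y * (\<integral>\<^sup>+x. \<gamma> (t *\<^sub>R y + (1 - t) *\<^sub>R x) \<partial>lborel) \<partial>lborel)"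
    by (subst nn_integral_cmult[symmetric], measurable)
       (auto intro!: nn_integral_mono simp: indicator_def algebra_simps)
  also have "\<dots> \<le> (\<integral>\<^sup>+y. indicator B y * (2 ^ DIM('a) * (\<integral>\<^sup>+x. \<gamma> x \<partial>lborel)) \<partial>lborel)"
    using False by (intro nn_integral_mono mult_left_mono nn_integral_lborel_affine_le) auto
  also have "\<dots> = emeasure lborel B * (2 ^ DIM('a) * (\<integral>\<^sup>+x. \<gamma> x \<partial>lborel))"
    by (simp add: nn_integral_multc)
  also have "\<dots> \<le> (emeasure lborel A + emeasure lborel B) * (2 ^ DIM('a) * (\<integral>\<^sup>+x. \<gamma> x \<partial>lborel))"
    by (intro mult_right_mono) auto
  finally show ?thesis by (simp add: mult_ac)
qed

text \<open>The difference formula and Cauchy-Schwarz bound (u x - u y)^2 by d^2 times the mean of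
  |g|^2 along the segment from x to y. Averaging over all pairs of endpoints turns these line
  integrals into the integral of |g|^2 over space.\<close>

lemma gap_segment_le:
  fixes u :: "real^'n \<Rightarrow> real"
  assumes w: "integrable_weak_gradient S u g" and S: "open S"
    and [measurable]: "A \<in> sets borel" "B \<in> sets borel"
    and seg: "\<And>x y t. x \<in> A \<Longrightarrow> y \<in> B \<Longrightarrow> 0 \<le> t \<Longrightarrow> t \<le> 1 \<Longrightarrow> x + t *\<^sub>R (y - x) \<in> S"
    and d: "\<And>x y. x \<in> A \<Longrightarrow> y \<in> B \<Longrightarrow> norm (y - x) \<le> d"
  shows "gap u A B \<le> ennreal (d\<^sup>2) * (2 ^ CARD('n) * (emeasure lborel A + emeasure lborel B))
    * (\<integral>\<^sup>+x. ennreal ((norm (g x))\<^sup>2) \<partial>lborel)"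
proof -
  let ?\<gamma> = "\<lambda>x. ennreal ((norm (g x))\<^sup>2)"
  have [measurable]: "u \<in> borel_measurable borel" "g \<in> borel_measurable borel"
    using w borel_measurable_integrable[of lborel u] borel_measurable_integrable[of lborel g]
    by (auto simp: integrable_weak_gradient_def)
  have "gap u A B = (\<integral>\<^sup>+x. \<integral>\<^sup>+h. indicator A x * indicator B (h + x) * ennreal ((u x - u (h + x))\<^sup>2) \<partial>lborel \<partial>lborel)"
    unfolding gap_def
    by (intro nn_integral_cong nn_integral_lborel_translate[symmetric]) measurable
  \<comment> \<open>The exceptional null set of the difference formula depends on the displacement
    \<open>h\<close>. So \<open>h\<close> has to become the outer variable before the formula is
    applied for almost every \<open>x\<close>.\<close>
  also have "\<dots> = (\<integral>\<^sup>+h. \<integral>\<^sup>+x. indicator A x * indicator B (h + x) * ennreal ((u x - u (h + x))\<^sup>2) \<partial>lborel \<partial>lborel)"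
    by (rule lborel_pair.Fubini') measurable
  also have "\<dots> \<le> (\<integral>\<^sup>+h. \<integral>\<^sup>+x. indicator A x * indicator B (h + x) *
      (\<integral>\<^sup>+t. indicator {0..1} t * (ennreal (d\<^sup>2) * ?\<gamma> (x + t *\<^sub>R h)) \<partial>lborel) \<partial>lborel \<partial>lborel)"
  proof (rule nn_integral_mono, rule nn_integral_mono_AE)
    fix h
    show "AE x in lborel. indicator A x * indicator B (h + x) * ennreal ((u x - u (h + x))\<^sup>2)
      \<le> indicator A x * indicator B (h + x) * (\<integral>\<^sup>+t. indicator {0..1} t * (ennreal (d\<^sup>2) * ?\<gamma> (x + t *\<^sub>R h)) \<partial>lborel)"
      using weak_gradient_difference[OF w S, of h]
    proof eventually_elim
      case (elim x)
      show ?case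
      proof (cases "x \<in> A \<and> h + x \<in> B")
        case True
        then have "\<forall>t\<in>{0..1}. x + t *\<^sub>R h \<in> S"
          using seg[of x "h + x"] by auto
        with elim have "u (x + h) - u x = (LINT t|lborel. indicator {0..1} t * (g (x + t *\<^sub>R h) \<bullet> h))"
          by simp
        then have "ennreal ((u x - u (h + x))\<^sup>2) = ennreal ((LINT t|lborel. indicator {0..1} t * (g (x + t *\<^sub>R h) \<bullet> h))\<^sup>2)"
          by (metis power2_commute add.commute)
        also have "\<dots> \<le> (\<integral>\<^sup>+t. indicator {0..1} t * ennreal ((g (x + t *\<^sub>R h) \<bullet> h)\<^sup>2) \<partial>lborel)"
          by (rule square_integral_unit_interval_le) measurable
        also have "\<dots> \<le> (\<integral>\<^sup>+t. indicator {0..1} t * (ennreal (d\<^sup>2) * ?\<gamma> (x + t *\<^sub>R h)) \<partial>lborel)"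
        proof (intro nn_integral_mono mult_left_mono)
          fix t
          have "norm h \<le> d" using d[of x "h + x"] True by simp
          then have "\<bar>g (x + t *\<^sub>R h) \<bullet> h\<bar> \<le> d * norm (g (x + t *\<^sub>R h))"
            using Cauchy_Schwarz_ineq2[of "g (x + t *\<^sub>R h)" h]
              mult_left_mono[of "norm h" d "norm (g (x + t *\<^sub>R h))"] by (simp add: mult.commute)
          then have "(g (x + t *\<^sub>R h) \<bullet> h)\<^sup>2 \<le> (d * norm (g (x + t *\<^sub>R h)))\<^sup>2"
            by (rule abs_le_square_iff[THEN iffD1, OF order_trans]) simp
          then show "ennreal ((g (x + t *\<^sub>R h) \<bullet> h)\<^sup>2) \<le> ennreal (d\<^sup>2) * ?\<gamma> (x + t *\<^sub>R h)"
            by (simp add: ennreal_mult[symmetric] power_mult_distrib ennreal_leI)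
        qed auto
        finally show ?thesis by (intro mult_left_mono) auto
      qed (auto simp: indicator_def)
    qed
  qed
  \<comment> \<open>Return to the endpoint y = h + x: for fixed \<open>t\<close> the remaining
    integral over pairs of endpoints is the one estimated by
    \<open>segment_average_le\<close>.\<close>
  also have "\<dots> = (\<integral>\<^sup>+x. \<integral>\<^sup>+h. indicator A x * indicator B (h + x) *
      (\<integral>\<^sup>+t. indicator {0..1} t * (ennreal (d\<^sup>2) * ?\<gamma> (x + t *\<^sub>R h)) \<partial>lborel) \<partial>lborel \<partial>lborel)"
    by (rule lborel_pair.Fubini') measurable
  also have "\<dots> = (\<integral>\<^sup>+x. \<integral>\<^sup>+y. indicator A x * indicator B y *
      (\<integral>\<^sup>+t. indicator {0..1} t * (ennreal (d\<^sup>2) * ?\<gamma> (x + t *\<^sub>R (y - x))) \<partial>lborel) \<partial>lborel \<partial>lborel)"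
  proof (rule nn_integral_cong)
    fix x
    let ?f = "\<lambda>y. indicator A x * indicator B y *
      (\<integral>\<^sup>+t. indicator {0..1} t * (ennreal (d\<^sup>2) * ?\<gamma> (x + t *\<^sub>R (y - x))) \<partial>lborel)"
    have "(\<integral>\<^sup>+h. ?f (h + x) \<partial>lborel) = (\<integral>\<^sup>+y. ?f y \<partial>lborel)"
      by (rule nn_integral_lborel_translate) measurable
    then show "(\<integral>\<^sup>+h. indicator A x * indicator B (h + x) *
      (\<integral>\<^sup>+t. indicator {0..1} t * (ennreal (d\<^sup>2) * ?\<gamma> (x + t *\<^sub>R h)) \<partial>lborel) \<partial>lborel) = (\<integral>\<^sup>+y. ?f y \<partial>lborel)"
      by simp
  qed
  also have "\<dots> = (\<integral>\<^sup>+x. \<integral>\<^sup>+y. \<integral>\<^sup>+t. ennreal (d\<^sup>2) * indicator {0..1} t * (indicator A x * indicator B y *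
      ?\<gamma> (x + t *\<^sub>R (y - x))) \<partial>lborel \<partial>lborel \<partial>lborel)"
    by (intro nn_integral_cong, subst nn_integral_cmult[symmetric]) (auto intro!: nn_integral_cong simp: mult_ac)
  also have "\<dots> = (\<integral>\<^sup>+x. \<integral>\<^sup>+t. \<integral>\<^sup>+y. ennreal (d\<^sup>2) * indicator {0..1} t * (indicator A x * indicator B y *
      ?\<gamma> (x + t *\<^sub>R (y - x))) \<partial>lborel \<partial>lborel \<partial>lborel)"
    by (intro nn_integral_cong lborel_pair.Fubini') measurable
  also have "\<dots> = (\<integral>\<^sup>+t. \<integral>\<^sup>+x. \<integral>\<^sup>+y. ennreal (d\<^sup>2) * indicator {0..1} t * (indicator A x * indicator B y *
      ?\<gamma> (x + t *\<^sub>R (y - x))) \<partial>lborel \<partial>lborel \<partial>lborel)"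
    by (intro lborel_pair.Fubini') measurable
  also have "\<dots> = (\<integral>\<^sup>+t. ennreal (d\<^sup>2) * indicator {0..1} t * (\<integral>\<^sup>+x. \<integral>\<^sup>+y. indicator A x * indicator B y *
      ?\<gamma> (x + t *\<^sub>R (y - x)) \<partial>lborel \<partial>lborel) \<partial>lborel)"
    by (simp add: nn_integral_cmult)
  also have "\<dots> \<le> (\<integral>\<^sup>+t. ennreal (d\<^sup>2) * indicator {0..1::real} t *
      (2 ^ CARD('n) * (emeasure lborel A + emeasure lborel B) * (\<integral>\<^sup>+x. ?\<gamma> x \<partial>lborel)) \<partial>lborel)"
    using segment_average_le[of ?\<gamma> A B] by (intro nn_integral_mono mult_left_mono) auto
  also have "\<dots> = ennreal (d\<^sup>2) * (2 ^ CARD('n) * (emeasure lborel A + emeasure lborel B) * (\<integral>\<^sup>+x. ?\<gamma> x \<partial>lborel))"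
    by (simp add: nn_integral_multc nn_integral_cmult)
  finally show ?thesis by (simp add: mult.assoc)
qed

section \<open>Linked sets and the chaining argument\<close>

definition linked :: "(real^'n) set \<Rightarrow> (real^'n) set \<Rightarrow> (real^'n) set \<Rightarrow> bool" where
  "linked S A B \<longleftrightarrow> (\<exists>C::real. C \<ge> 0 \<and> (\<forall>u g. integrable_weak_gradient S u g \<longrightarrow>
     gap u A B \<le> ennreal C * (\<integral>\<^sup>+x. ennreal ((norm (g x))\<^sup>2) \<partial>lborel)))"

lemma integrable_weak_gradient_measurable:
  assumes "integrable_weak_gradient S u g"
  shows "u \<in> borel_measurable borel" "g \<in> borel_measurable borel"
  using assms borel_measurable_integrable[of lborel u] borel_measurable_integrable[of lborel g]
  by (auto simp: integrable_weak_gradient_def)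

text \<open>Boundedness makes both measures and the distances between the two sets finite, hence
  also the constant of \<open>gap_segment_le\<close>.\<close>

lemma linked_segments:
  fixes S :: "(real^'n) set"
  assumes S: "open S" and AB: "A \<in> sets borel" "B \<in> sets borel" "bounded A" "bounded B"
    and seg: "\<And>x y t. x \<in> A \<Longrightarrow> y \<in> B \<Longrightarrow> 0 \<le> t \<Longrightarrow> t \<le> 1 \<Longrightarrow> x + t *\<^sub>R (y - x) \<in> S"
  shows "linked S A B"
proof -
  obtain a b where "\<And>x. x \<in> A \<Longrightarrow> norm x \<le> a" "\<And>y. y \<in> B \<Longrightarrow> norm y \<le> b"
    using AB by (auto simp: bounded_iff)
  then have d: "norm (y - x) \<le> a + b" if "x \<in> A" "y \<in> B" for x y
    using that norm_triangle_ineq4[of y x] by force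
  have fin: "emeasure lborel A = ennreal (measure lborel A)" "emeasure lborel B = ennreal (measure lborel B)"
    using AB emeasure_bounded_finite[of A] emeasure_bounded_finite[of B]
    by (auto simp: emeasure_eq_ennreal_measure)
  have "ennreal ((a + b)\<^sup>2) * (2 ^ CARD('n) * (emeasure lborel A + emeasure lborel B))
      = ennreal ((a + b)\<^sup>2 * (2 ^ CARD('n) * (measure lborel A + measure lborel B)))"
    unfolding fin by (simp add: ennreal_mult ennreal_plus ennreal_power[symmetric])
  with gap_segment_le[OF _ S AB(1,2) seg d] show ?thesis
    unfolding linked_def
    by (intro exI[of _ "(a + b)\<^sup>2 * (2 ^ CARD('n) * (measure lborel A + measure lborel B))"]) simp
qed

lemma linked_sym:
  assumes "linked S A B" "A \<in> sets borel" "B \<in> sets borel"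
  shows "linked S B A"
  using assms gap_sym[of _ A B] integrable_weak_gradient_measurable unfolding linked_def by metis

lemma linked_mono:
  assumes "linked S A B" "A' \<subseteq> A" "B' \<subseteq> B"
  shows "linked S A' B'"
  using assms(1) gap_mono[OF assms(2,3)] unfolding linked_def by (meson order_trans)

lemma linked_Un:
  assumes "linked S A B" "linked S A' B" "A \<in> sets borel" "A' \<in> sets borel" "B \<in> sets borel"
  shows "linked S (A \<union> A') B"
proof -
  obtain C C' where C: "C \<ge> 0" "C' \<ge> 0"
    "\<And>u g. integrable_weak_gradient S u g \<Longrightarrow> gap u A B \<le> ennreal C * (\<integral>\<^sup>+x. ennreal ((norm (g x))\<^sup>2) \<partial>lborel)"
    "\<And>u g. integrable_weak_gradient S u g \<Longrightarrow> gap u A' B \<le> ennreal C' * (\<integral>\<^sup>+x. ennreal ((norm (g x))\<^sup>2) \<partial>lborel)"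
    using assms unfolding linked_def by metis
  have "gap u (A \<union> A') B \<le> ennreal (C + C') * (\<integral>\<^sup>+x. ennreal ((norm (g x))\<^sup>2) \<partial>lborel)"
    if w: "integrable_weak_gradient S u g" for u g
    using order_trans[OF gap_Un_le[OF integrable_weak_gradient_measurable(1)[OF w] assms(3,4,5)]
      add_mono[OF C(3,4)[OF w]]] C(1,2)
    by (simp add: distrib_right)
  then show ?thesis using C(1,2) unfolding linked_def by (intro exI[of _ "C + C'"]) auto
qed

lemma linked_UN:
  assumes "finite I" "\<And>i. i \<in> I \<Longrightarrow> linked S (A i) B" "\<And>i. i \<in> I \<Longrightarrow> A i \<in> sets borel" "B \<in> sets borel"
  shows "linked S (\<Union>i\<in>I. A i) B"
  using assms
proof (induction I rule: finite_induct)
  case empty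
  then show ?case by (auto simp: linked_def gap_def intro!: exI[of _ 0])
next
  case (insert i I)
  then have "linked S (A i \<union> (\<Union>i\<in>I. A i)) B"
    by (intro linked_Un sets.finite_UN) auto
  then show ?case by simp
qed

lemma linked_trans:
  assumes "linked S A B" "linked S B C" "A \<in> sets borel" "B \<in> sets borel" "C \<in> sets borel"
    and "bounded A" "bounded C" "emeasure lborel B > 0" "bounded B"
  shows "linked S A C"
proof -
  let ?m = "measure lborel"
  obtain c c' where c: "c \<ge> 0" "c' \<ge> 0"
    "\<And>u g. integrable_weak_gradient S u g \<Longrightarrow> gap u A B \<le> ennreal c * (\<integral>\<^sup>+x. ennreal ((norm (g x))\<^sup>2) \<partial>lborel)"
    "\<And>u g. integrable_weak_gradient S u g \<Longrightarrow> gap u B C \<le> ennreal c' * (\<integral>\<^sup>+x. ennreal ((norm (g x))\<^sup>2) \<partial>lborel)"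
    using assms unfolding linked_def by metis
  have fin: "emeasure lborel D = ennreal (?m D)" if "bounded D" for D :: "(real^'a) set"
    using emeasure_bounded_finite[OF that] by (auto simp: emeasure_eq_ennreal_measure)
  have mB: "?m B > 0"
    using assms(8) fin[OF assms(9)] by simp
  \<comment> \<open>The constant of \<open>gap_trans\<close> after division by the measure of
    \<open>B\<close>, which is the reason for requiring a positive measure.\<close>
  define K where "K = 2 * (?m C * c + ?m A * c') / ?m B"
  have K: "K \<ge> 0" using c mB by (simp add: K_def)
  have "gap u A C \<le> ennreal K * (\<integral>\<^sup>+x. ennreal ((norm (g x))\<^sup>2) \<partial>lborel)"
    if w: "integrable_weak_gradient S u g" for u g
  proof -
    let ?I = "\<integral>\<^sup>+x. ennreal ((norm (g x))\<^sup>2) \<partial>lborel"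
    have "ennreal (?m B) * gap u A C \<le> 2 * (ennreal (?m C) * gap u A B + ennreal (?m A) * gap u B C)"
      using gap_trans[OF integrable_weak_gradient_measurable(1)[OF w] assms(3,4,5)]
      by (simp only: fin assms(6,7,9))
    also have "\<dots> \<le> 2 * (ennreal (?m C) * (ennreal c * ?I) + ennreal (?m A) * (ennreal c' * ?I))"
      by (intro mult_left_mono add_mono c w) auto
    also have "\<dots> = ennreal (2 * (?m C * c + ?m A * c')) * ?I"
      using c by (simp add: ennreal_mult ennreal_plus distrib_left distrib_right mult.assoc)
    finally have le: "ennreal (?m B) * gap u A C \<le> ennreal (2 * (?m C * c + ?m A * c')) * ?I" .
    have "gap u A C = ennreal (1 / ?m B) * (ennreal (?m B) * gap u A C)"
      using mB by (simp add: mult.assoc[symmetric] ennreal_mult[symmetric])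
    also have "\<dots> \<le> ennreal (1 / ?m B) * (ennreal (2 * (?m C * c + ?m A * c')) * ?I)"
      by (intro mult_left_mono le) auto
    also have "\<dots> = ennreal (1 / ?m B * (2 * (?m C * c + ?m A * c'))) * ?I"
      using c mB by (subst ennreal_mult) (simp_all add: mult.assoc)
    also have "1 / ?m B * (2 * (?m C * c + ?m A * c')) = K"
      by (simp add: K_def)
    finally show ?thesis .
  qed
  with K show ?thesis unfolding linked_def by blast
qed

lemma emeasure_ball_pos: "r > 0 \<Longrightarrow> emeasure lborel (ball (x::real^'n) r) > 0"
  using content_ball_pos[of r x] by (simp add: measure_def enn2real_positive_iff)

lemma linked_ball:
  assumes "open S" "ball x r \<subseteq> S"
  shows "linked S (ball x r) (ball x r)"
proof (rule linked_segments)
  fix y z and t :: real assume "y \<in> ball x r" "z \<in> ball x r" "0 \<le> t" "t \<le> 1"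
  then have "(1 - t) *\<^sub>R y + t *\<^sub>R z \<in> ball x r"
    by (intro convexD[OF convex_ball]) auto
  then show "y + t *\<^sub>R (z - y) \<in> S"
    using assms(2) by (auto simp: algebra_simps)
qed (use assms in auto)

text \<open>Below a Lipschitz graph, a neighbourhood of a boundary point sees a small ball that lies
  sufficiently deep in the direction \<open>-e\<close>.\<close>

lemma linked_boundary_chart:
  fixes S :: "(real^'n) set"
  assumes S: "open S" and x: "x \<in> closure S" and r: "r > 0" and e: "norm e = 1"
    and lip: "L-lipschitz_on {z. z \<bullet> e = 0} \<psi>"
    and chart: "S \<inter> ball x r = {y \<in> ball x r. y \<bullet> e < \<psi> (y - (y \<bullet> e) *\<^sub>R e)}"
  obtains \<delta> z \<rho> where "\<delta> > 0" "\<rho> > 0" "ball z \<rho> \<subseteq> S" "linked S (S \<inter> ball x \<delta>) (ball z \<rho>)"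
proof -
  have L: "L \<ge> 0" using lip by (rule lipschitz_on_nonneg)
  \<comment> \<open>Points within \<delta> of \<open>x\<close> and of \<open>z\<close> are joined by
    the vector from \<open>x\<close> to \<open>z\<close> plus an error of norm at most 2 \<delta>.
    The depth 2 (1 + 2L) \<delta> absorbs the vertical error and leaves a descent of at least 4 L
    \<delta>. The lateral motion is at most 4 \<delta>, so the graph drops by at most 4 L \<delta>,
    and in proportion along the segment. The ball around \<open>z\<close> reaches out to (3 + 4L)
    \<delta>, which the choice of \<delta> keeps below \<open>r\<close>.\<close>
  define \<delta> where "\<delta> = r / (4 + 4 * L)"
  define z where "z = x - (2 * (1 + 2 * L) * \<delta>) *\<^sub>R e"
  have \<delta>: "\<delta> > 0" "(4 + 4 * L) * \<delta> = r"
    using r L by (auto simp: \<delta>_def)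
  have \<delta>r: "\<delta> \<le> r"
    using mult_right_mono[of 1 "4 + 4 * L" \<delta>] \<delta> L by simp
  have ee: "e \<bullet> e = 1" using e by (simp add: dot_square_norm)
  let ?P = "\<lambda>y. y - (y \<bullet> e) *\<^sub>R e"
  have z_in: "ball z \<delta> \<subseteq> ball x r"
  proof
    fix y assume "y \<in> ball z \<delta>"
    moreover have "dist x z = 2 * (1 + 2 * L) * \<delta>"
      using \<delta>(1) L e by (simp add: z_def dist_norm)
    ultimately have "dist x y < 2 * (1 + 2 * L) * \<delta> + \<delta>"
      using dist_triangle[of x y z] by simp
    also have "\<dots> \<le> r"
      using \<delta> L by (simp add: algebra_simps)
    finally show "y \<in> ball x r" by simp
  qed
  have seg: "y + t *\<^sub>R (y' - y) \<in> S"
    if y: "y \<in> S \<inter> ball x \<delta>" and y': "y' \<in> ball z \<delta>" and t: "0 \<le> t" "t \<le> 1" for y y' t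
  proof -
    define p where "p = y + t *\<^sub>R (y' - y)"
    define w where "w = (y' - z) + (x - y)"
    have yr: "y \<in> S \<inter> ball x r" using y \<delta>r by auto
    have "(1 - t) *\<^sub>R y + t *\<^sub>R y' \<in> ball x r"
      using t yr y' z_in by (intro convexD[OF convex_ball]) auto
    then have p_in: "p \<in> ball x r" by (simp add: p_def algebra_simps)
    have w: "norm w \<le> 2 * \<delta>"
      using y y' norm_triangle_ineq[of "y' - z" "x - y"] by (simp add: w_def dist_norm norm_minus_commute)
    have y'y: "y' - y = w - (2 * (1 + 2 * L) * \<delta>) *\<^sub>R e"
      by (simp add: w_def z_def)
    have we: "\<bar>w \<bullet> e\<bar> \<le> 2 * \<delta>"
      using Cauchy_Schwarz_ineq2[of w e] w e by simp
    have "(y' - y) \<bullet> e = w \<bullet> e - 2 * (1 + 2 * L) * \<delta>"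
      by (simp add: y'y inner_diff_left ee)
    then have down: "(y' - y) \<bullet> e \<le> - (4 * L * \<delta>)"
      using we by (simp add: algebra_simps)
    have "?P (y' - y) = ?P w"
      by (simp add: y'y inner_diff_left ee algebra_simps)
    then have "norm (?P (y' - y)) \<le> norm w + norm ((w \<bullet> e) *\<^sub>R e)"
      using norm_triangle_ineq4[of w "(w \<bullet> e) *\<^sub>R e"] by simp
    then have side: "norm (?P (y' - y)) \<le> 4 * \<delta>"
      using w we e by simp
    have "?P p - ?P y = t *\<^sub>R ?P (y' - y)"
      by (simp add: p_def inner_add_left inner_diff_left algebra_simps)
    then have "dist (?P y) (?P p) = t * norm (?P (y' - y))"
      using t by (metis abs_of_nonneg dist_commute dist_norm norm_scaleR)
    moreover have "dist (\<psi> (?P y)) (\<psi> (?P p)) \<le> L * dist (?P y) (?P p)"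
      by (rule lipschitz_onD[OF lip]) (auto simp: inner_diff_left ee)
    ultimately have "\<bar>\<psi> (?P y) - \<psi> (?P p)\<bar> \<le> L * (t * norm (?P (y' - y)))"
      by (simp add: dist_real_def)
    also have "\<dots> \<le> L * (t * (4 * \<delta>))"
      using side t L by (intro mult_left_mono) auto
    finally have "\<psi> (?P y) - L * (t * (4 * \<delta>)) \<le> \<psi> (?P p)" by linarith
    moreover have "p \<bullet> e = y \<bullet> e + t * ((y' - y) \<bullet> e)"
      by (simp add: p_def inner_add_left)
    moreover have "t * ((y' - y) \<bullet> e) \<le> t * - (4 * L * \<delta>)"
      using down t by (intro mult_left_mono) auto
    moreover have "y \<bullet> e < \<psi> (?P y)"
      using yr unfolding chart by simp
    moreover have "t * - (4 * L * \<delta>) = - (L * (t * (4 * \<delta>)))"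
      by simp
    ultimately have "p \<bullet> e < \<psi> (?P p)"
      by linarith
    then have "p \<in> S \<inter> ball x r"
      using p_in unfolding chart by simp
    then show ?thesis by (simp add: p_def)
  qed
  \<comment> \<open>The ball around \<open>z\<close> lies in \<open>S\<close> by the segment
    property at t = 1, for which a single starting point \<open>y\<close> is enough.\<close>
  obtain y where y: "y \<in> S \<inter> ball x \<delta>"
    using x \<delta>(1) by (metis closure_approachable dist_commute IntI mem_ball)
  have "ball z \<delta> \<subseteq> S"
    using seg[OF y, of _ 1] by auto
  moreover have "linked S (S \<inter> ball x \<delta>) (ball z \<delta>)"
    using seg S by (intro linked_segments) (auto intro: bounded_subset[OF bounded_ball])
  ultimately show ?thesis using that \<delta>(1) by blast
qed

lemma linked_locally:
  assumes S: "lipschitz_domain S" and x: "x \<in> closure S"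
  obtains \<delta> z \<rho> where "\<delta> > 0" "\<rho> > 0" "ball z \<rho> \<subseteq> S" "linked S (S \<inter> ball x \<delta>) (ball z \<rho>)"
proof (cases "x \<in> S")
  case True
  have "open S" using S by (simp add: lipschitz_domain_def)
  then obtain \<delta> where "\<delta> > 0" "ball x \<delta> \<subseteq> S"
    using True openE by metis
  then show ?thesis
    using that[of \<delta> \<delta> x] linked_mono[OF linked_ball[OF \<open>open S\<close>, of x \<delta>]] by blast
next
  case False
  have "open S" using S by (simp add: lipschitz_domain_def)
  then have "x \<in> frontier S"
    using False x by (simp add: frontier_def interior_open)
  with S have "\<exists>r>0. \<exists>e \<psi> L. norm e = 1 \<and> L-lipschitz_on {z. z \<bullet> e = 0} \<psi> \<and>
      S \<inter> ball x r = {y \<in> ball x r. y \<bullet> e < \<psi> (y - (y \<bullet> e) *\<^sub>R e)}"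
    unfolding lipschitz_domain_def by (elim conjE) (erule (1) bspec)
  then obtain r e \<psi> L where c: "r > 0" "norm e = 1" "L-lipschitz_on {z. z \<bullet> e = 0} \<psi>"
    "S \<inter> ball x r = {y \<in> ball x r. y \<bullet> e < \<psi> (y - (y \<bullet> e) *\<^sub>R e)}"
    by (elim exE conjE) (rule that)
  show ?thesis
    by (rule linked_boundary_chart[OF \<open>open S\<close> x c]) (rule that)
qed

lemma linked_lipschitz_domain:
  fixes S :: "(real^'n) set"
  assumes S: "lipschitz_domain S"
  shows "linked S S S"
proof -
  have op: "open S" and con: "connected S" and bd: "bounded S" and "S \<noteq> {}"
    using S by (auto simp: lipschitz_domain_def)
  then obtain x0 \<rho>0 where b0: "x0 \<in> S" "\<rho>0 > 0" "ball x0 \<rho>0 \<subseteq> S"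
    by (meson all_not_in_conv openE)
  define B0 where "B0 = ball x0 \<rho>0"
  \<comment> \<open>\<open>P\<close> and \<open>S - P\<close> will both be open, so that
    connectedness gives P = S.\<close>
  define P where "P = {x \<in> S. \<exists>\<delta>>0. linked S (ball x \<delta>) B0}"
  have B0: "B0 \<in> sets borel" "bounded B0" "emeasure lborel B0 > 0"
    using b0 emeasure_ball_pos by (auto simp: B0_def)
  \<comment> \<open>One point of \<open>P\<close> in a ball inside \<open>S\<close> links the whole
    ball to \<open>B0\<close>: a small ball around that point lies in both and has the positive
    measure needed for transitivity. Openness of \<open>P\<close> and of \<open>S - P\<close> both
    follow from this.\<close>
  have spread: "linked S (ball x \<delta>) B0" if \<delta>: "\<delta> > 0" "ball x \<delta> \<subseteq> S" and y: "y \<in> P" "y \<in> ball x \<delta>" for x y \<delta>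
  proof -
    obtain \<eta> where \<eta>: "\<eta> > 0" "linked S (ball y \<eta>) B0"
      using y(1) by (auto simp: P_def)
    define \<epsilon> where "\<epsilon> = min \<eta> (\<delta> - dist x y)"
    have "z \<in> ball x \<delta>" if "z \<in> ball y \<epsilon>" for z
      using that dist_triangle[of x z y] by (simp add: \<epsilon>_def)
    then have \<epsilon>: "\<epsilon> > 0" "ball y \<epsilon> \<subseteq> ball x \<delta>" "ball y \<epsilon> \<subseteq> ball y \<eta>"
      using y(2) \<eta> by (auto simp: \<epsilon>_def)
    show ?thesis
    proof (rule linked_trans)
      show "linked S (ball x \<delta>) (ball y \<epsilon>)"
        using linked_mono[OF linked_ball[OF op \<delta>(2)]] \<epsilon> by blast
      show "linked S (ball y \<epsilon>) B0"
        using linked_mono[OF \<eta>(2)] \<epsilon> by blast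
    qed (use B0 \<epsilon>(1) emeasure_ball_pos in auto)
  qed
  have "open P"
  proof (rule openI)
    fix x assume x: "x \<in> P"
    then obtain \<delta> where \<delta>: "\<delta> > 0" "ball x \<delta> \<subseteq> S"
      using op openE by (auto simp: P_def)
    have "y \<in> P" if y: "y \<in> ball x \<delta>" for y
    proof -
      obtain \<epsilon> where "\<epsilon> > 0" "ball y \<epsilon> \<subseteq> ball x \<delta>"
        using openE[OF open_ball y] by metis
      then have "linked S (ball y \<epsilon>) B0"
        using linked_mono[OF spread[OF \<delta> x]] \<delta>(1) by auto
      with \<open>\<epsilon> > 0\<close> y \<delta>(2) show ?thesis by (auto simp: P_def)
    qed
    with \<delta>(1) show "\<exists>\<epsilon>>0. ball x \<epsilon> \<subseteq> P" by blast
  qed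
  moreover have "open (S - P)"
  proof (rule openI)
    fix x assume x: "x \<in> S - P"
    then obtain \<delta> where \<delta>: "\<delta> > 0" "ball x \<delta> \<subseteq> S"
      using op openE by auto
    have "y \<notin> P" if "y \<in> ball x \<delta>" for y
      using spread[OF \<delta>] that x \<delta>(1) by (auto simp: P_def)
    with \<delta> show "\<exists>\<epsilon>>0. ball x \<epsilon> \<subseteq> S - P" by blast
  qed
  moreover have "x0 \<in> P"
    using b0 linked_ball[OF op b0(3)] by (auto simp: P_def B0_def)
  ultimately have "S - P = {}"
    using connectedD[OF con, of P "S - P"] b0(1) by blast
  then have P: "P = S" by (auto simp: P_def)
  have "\<exists>\<delta>>0. linked S (S \<inter> ball x \<delta>) B0" if x: "x \<in> closure S" for x
  proof -
    obtain \<delta> z \<rho> where \<delta>: "\<delta> > 0" "\<rho> > 0" "ball z \<rho> \<subseteq> S" "linked S (S \<inter> ball x \<delta>) (ball z \<rho>)"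
      using linked_locally[OF S x] by metis
    have "linked S (S \<inter> ball x \<delta>) B0"
    proof (rule linked_trans[OF \<delta>(4)])
      show "linked S (ball z \<rho>) B0"
        using spread[OF \<delta>(2,3), of z] \<delta>(2) subsetD[OF \<delta>(3), of z] P by simp
      show "bounded (S \<inter> ball x \<delta>)" by (simp add: bounded_Int)
    qed (use B0 \<delta>(2) op emeasure_ball_pos in simp_all)
    with \<delta>(1) show ?thesis by blast
  qed
  then obtain \<delta> where \<delta>: "\<And>x. x \<in> closure S \<Longrightarrow> \<delta> x > 0 \<and> linked S (S \<inter> ball x (\<delta> x)) B0"
    by metis
  have "compact (closure S)" using bd by (simp add: compact_closure)
  moreover have "closure S \<subseteq> (\<Union>x\<in>closure S. ball x (\<delta> x))"
  proof
    fix x assume "x \<in> closure S"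
    with \<delta> show "x \<in> (\<Union>x\<in>closure S. ball x (\<delta> x))" by (intro UN_I[of x]) auto
  qed
  ultimately obtain I where I: "I \<subseteq> closure S" "finite I" "closure S \<subseteq> (\<Union>x\<in>I. ball x (\<delta> x))"
    using compactE_image[of "closure S" "closure S" "\<lambda>x. ball x (\<delta> x)"] open_ball by metis
  have "linked S (\<Union>x\<in>I. S \<inter> ball x (\<delta> x)) B0"
    using I \<delta> B0 op by (intro linked_UN) auto
  moreover have "(\<Union>x\<in>I. S \<inter> ball x (\<delta> x)) = S"
    using I(3) closure_subset[of S] by blast
  ultimately have "linked S S B0" by simp
  moreover from this have "linked S B0 S"
    by (rule linked_sym) (use op B0(1) in auto)
  ultimately show ?thesis
    by (rule linked_trans) (use B0 op bd in auto)
qed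

section \<open>Borel representatives and square integrable functions\<close>

lemma lebesgue_on_eq_lborel:
  fixes f f' :: "'a::euclidean_space \<Rightarrow> 'b::euclidean_space"
  assumes S: "S \<in> sets lebesgue" and f: "f \<in> borel_measurable (lebesgue_on S)"
    and f': "f' \<in> borel_measurable borel"
    and eq: "AE x in lborel. indicator S x *\<^sub>R f x = f' x"
  shows "integrable (lebesgue_on S) f \<longleftrightarrow> integrable lborel f'"
    and "(LINT x|lebesgue_on S. f x) = (LINT x|lborel. f' x)"
proof -
  have m: "(\<lambda>x. indicator S x *\<^sub>R f x) \<in> borel_measurable lebesgue"
    using f S by (subst (asm) borel_measurable_restrict_space_iff) auto
  have m': "f' \<in> borel_measurable lebesgue" using f' by (simp add: measurable_completion)
  have ae: "AE x in lebesgue. indicator S x *\<^sub>R f x = f' x" using eq by (rule AE_completion)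
  have "integrable (lebesgue_on S) f \<longleftrightarrow> integrable lebesgue (\<lambda>x. indicator S x *\<^sub>R f x)"
    using S by (intro integrable_restrict_space) simp
  also have "\<dots> \<longleftrightarrow> integrable lebesgue f'"
    by (rule integrable_cong_AE[OF m m' ae])
  finally show "integrable (lebesgue_on S) f \<longleftrightarrow> integrable lborel f'"
    using f' by (simp add: integrable_completion)
  have "(LINT x|lebesgue_on S. f x) = (LINT x|lebesgue. indicator S x *\<^sub>R f x)"
    using S by (intro integral_restrict_space) simp
  also have "\<dots> = (LINT x|lebesgue. f' x)"
    by (rule integral_cong_AE[OF m m' ae])
  finally show "(LINT x|lebesgue_on S. f x) = (LINT x|lborel. f' x)"
    using f' by (simp add: integral_completion)
qed

text \<open>The chaining argument uses Fubini's theorem for Borel functions, whereas the spaces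
  consist of Lebesgue measurable ones. Each coordinate agrees almost everywhere with a Borel
  function; multiplying by the indicator makes the representative vanish outside \<open>S\<close>
  everywhere, not just almost everywhere.\<close>

lemma borel_representative:
  fixes f :: "'a::euclidean_space \<Rightarrow> 'b::euclidean_space"
  assumes S: "S \<in> sets borel" and f: "f \<in> borel_measurable (lebesgue_on S)"
  obtains f' where "f' \<in> borel_measurable borel" "AE x in lborel. indicator S x *\<^sub>R f x = f' x"
    "\<And>x. x \<notin> S \<Longrightarrow> f' x = 0"
proof -
  have m: "(\<lambda>x. indicator S x *\<^sub>R f x) \<in> borel_measurable lebesgue"
    using f S by (subst (asm) borel_measurable_restrict_space_iff) auto
  have "\<forall>b. \<exists>c. c \<in> borel_measurable borel \<and> (AE x in lborel. (indicator S x *\<^sub>R f x) \<bullet> b = c x)"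
  proof
    fix b
    have "(\<lambda>x. (indicator S x *\<^sub>R f x) \<bullet> b) \<in> borel_measurable lebesgue"
      using m by measurable
    from completion_ex_borel_measurable_real[OF this]
    show "\<exists>c. c \<in> borel_measurable borel \<and> (AE x in lborel. (indicator S x *\<^sub>R f x) \<bullet> b = c x)"
      by auto
  qed
  from choice[OF this] obtain c where c: "\<And>b. c b \<in> borel_measurable borel"
    "\<And>b. AE x in lborel. (indicator S x *\<^sub>R f x) \<bullet> b = c b x"
    by blast
  have "AE x in lborel. \<forall>b\<in>Basis. (indicator S x *\<^sub>R f x) \<bullet> b = c b x"
    by (intro AE_finite_allI c) simp
  then have ae: "AE x in lborel. indicator S x *\<^sub>R f x = indicator S x *\<^sub>R (\<Sum>b\<in>Basis. c b x *\<^sub>R b)"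
  proof eventually_elim
    case (elim x)
    have "indicator S x *\<^sub>R f x = (\<Sum>b\<in>Basis. ((indicator S x *\<^sub>R f x) \<bullet> b) *\<^sub>R b)"
      by (simp only: euclidean_representation)
    also have "\<dots> = (\<Sum>b\<in>Basis. c b x *\<^sub>R b)" using elim by simp
    finally show ?case by (auto simp: indicator_def)
  qed
  show ?thesis
    by (rule that[OF _ ae]) (use c S in \<open>auto intro!: borel_measurable_scaleR borel_measurable_sum\<close>)
qed

lemma l2_norm_square: "(l2_norm S f)\<^sup>2 = (LINT x|lebesgue_on S. (norm (f x))\<^sup>2)"
  by (simp add: l2_norm_def l2_inner_def power2_norm_eq_inner)

lemma L2_D: "f \<in> L2 S \<Longrightarrow> f \<in> borel_measurable (lebesgue_on S)"
  "f \<in> L2 S \<Longrightarrow> integrable (lebesgue_on S) (\<lambda>x. (norm (f x))\<^sup>2)"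
  by (auto simp: L2_def)

lemma norm_sub_square_le: "(norm (a - b))\<^sup>2 \<le> 2 * (norm a)\<^sup>2 + 2 * (norm b)\<^sup>2" for a b :: "'a::real_inner"
proof -
  have "0 \<le> (norm (a + b))\<^sup>2" by simp
  then show ?thesis
    by (simp add: power2_norm_eq_inner inner_diff_left inner_diff_right inner_add_left inner_add_right inner_commute)
qed

lemma L2_diff:
  assumes "f \<in> L2 S" "g \<in> L2 S"
  shows "(\<lambda>x. f x - g x) \<in> L2 S"
proof -
  have m: "f \<in> borel_measurable (lebesgue_on S)" "g \<in> borel_measurable (lebesgue_on S)"
    using assms by (auto dest: L2_D)
  have "integrable (lebesgue_on S) (\<lambda>x. (norm (f x - g x))\<^sup>2)"
  proof (rule Bochner_Integration.integrable_bound)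
    show "integrable (lebesgue_on S) (\<lambda>x. 2 * (norm (f x))\<^sup>2 + 2 * (norm (g x))\<^sup>2)"
      using assms by (simp add: L2_D)
    show "AE x in lebesgue_on S. norm ((norm (f x - g x))\<^sup>2) \<le> norm (2 * (norm (f x))\<^sup>2 + 2 * (norm (g x))\<^sup>2)"
      using norm_sub_square_le by (intro AE_I2) auto
  qed (use m in measurable)
  then show ?thesis using m by (simp add: L2_def)
qed

text \<open>The squared form follows from a pointwise inequality, at the price of the factor
  2.\<close>

lemma l2_norm_square_triangle:
  assumes "f \<in> L2 S" "g \<in> L2 S"
  shows "(l2_norm S f)\<^sup>2 \<le> 2 * (l2_norm S (\<lambda>x. f x - g x))\<^sup>2 + 2 * (l2_norm S g)\<^sup>2"
proof -
  have "(norm (f x))\<^sup>2 \<le> 2 * (norm (f x - g x))\<^sup>2 + 2 * (norm (g x))\<^sup>2" for x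
    using norm_sub_square_le[of "f x - g x" "- g x"] by simp
  then have "(LINT x|lebesgue_on S. (norm (f x))\<^sup>2)
      \<le> (LINT x|lebesgue_on S. 2 * (norm (f x - g x))\<^sup>2 + 2 * (norm (g x))\<^sup>2)"
    using assms L2_diff[OF assms] by (intro integral_mono) (simp_all add: L2_D)
  then show ?thesis
    using assms L2_diff[OF assms] by (simp add: l2_norm_square L2_D)
qed

lemma integrable_lebesgue_on_const:
  assumes "bounded S" "S \<in> sets lebesgue"
  shows "integrable (lebesgue_on S) (\<lambda>x. c :: real)"
proof -
  have "S \<in> lmeasurable"
    using assms by (rule bounded_set_imp_lmeasurable)
  then have "finite_measure (lebesgue_on S)"
    using assms(2) by (intro finite_measureI) (auto simp: emeasure_restrict_space fmeasurable_def)
  then show ?thesis by (rule finite_measure.integrable_const)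
qed

lemma L2_integrable:
  fixes f :: "'a::euclidean_space \<Rightarrow> 'b::euclidean_space"
  assumes S: "bounded S" "S \<in> sets lebesgue" and f: "f \<in> L2 S"
  shows "integrable (lebesgue_on S) f"
proof (rule Bochner_Integration.integrable_bound)
  show "integrable (lebesgue_on S) (\<lambda>x. 1 + (norm (f x))\<^sup>2)"
    using integrable_lebesgue_on_const[OF S] L2_D[OF f] by simp
  have "a \<le> 1 + a\<^sup>2" for a :: real
    using zero_le_power2[of "a - 1 / 2"] by (simp add: power2_eq_square algebra_simps)
  then show "AE x in lebesgue_on S. norm (f x) \<le> norm (1 + (norm (f x))\<^sup>2)"
    by (intro AE_I2) simp
qed (use f in \<open>auto dest: L2_D\<close>)

lemma bounded_L2:
  assumes S: "bounded S" "S \<in> sets lebesgue" and f: "f \<in> borel_measurable borel" "\<And>x. norm (f x) \<le> M"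
  shows "f \<in> L2 S"
proof -
  have m: "f \<in> borel_measurable (lebesgue_on S)"
    using f(1) by (intro measurable_restrict_space1 measurable_completion) simp
  have "integrable (lebesgue_on S) (\<lambda>x. (norm (f x))\<^sup>2)"
  proof (rule Bochner_Integration.integrable_bound[OF integrable_lebesgue_on_const[OF S, of "M\<^sup>2"]])
    show "AE x in lebesgue_on S. norm ((norm (f x))\<^sup>2) \<le> norm (M\<^sup>2)"
      using f(2) by (intro AE_I2) (simp add: power_mono)
  qed (use m in measurable)
  with m show ?thesis by (simp add: L2_def)
qed

lemma L2_representative:
  fixes f :: "'a::euclidean_space \<Rightarrow> 'b::euclidean_space"
  assumes S: "open S" "bounded S" and f: "f \<in> L2 S"
  obtains f' where "f' \<in> borel_measurable borel" "AE x in lborel. indicator S x *\<^sub>R f x = f' x"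
    "\<And>x. x \<notin> S \<Longrightarrow> f' x = 0" "integrable lborel f'" "integrable lborel (\<lambda>x. (norm (f' x))\<^sup>2)"
    "(LINT x|lborel. f' x) = (LINT x|lebesgue_on S. f x)"
    "(LINT x|lborel. (norm (f' x))\<^sup>2) = (l2_norm S f)\<^sup>2"
proof -
  have S': "S \<in> sets borel" "S \<in> sets lebesgue" using S by auto
  obtain f' where f': "f' \<in> borel_measurable borel" "AE x in lborel. indicator S x *\<^sub>R f x = f' x"
    "\<And>x. x \<notin> S \<Longrightarrow> f' x = 0"
    using borel_representative[OF S'(1) L2_D(1)[OF f]] by metis
  note 1 = lebesgue_on_eq_lborel[OF S'(2) L2_D(1)[OF f] f'(1,2)]
  have sq: "AE x in lborel. indicator S x *\<^sub>R (norm (f x))\<^sup>2 = (norm (f' x))\<^sup>2"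
    using f'(2) by eventually_elim (auto simp: indicator_def)
  have "(\<lambda>x. (norm (f x))\<^sup>2) \<in> borel_measurable (lebesgue_on S)" "(\<lambda>x. (norm (f' x))\<^sup>2) \<in> borel_measurable borel"
    using L2_D(1)[OF f] f'(1) by measurable
  note 2 = lebesgue_on_eq_lborel[OF S'(2) this sq]
  show ?thesis
  proof (rule that[OF f'])
    show "integrable lborel f'" "integrable lborel (\<lambda>x. (norm (f' x))\<^sup>2)"
      using 1(1) 2(1) L2_integrable[OF S(2) S'(2) f] L2_D(2)[OF f] by blast+
    show "(LINT x|lborel. f' x) = (LINT x|lebesgue_on S. f x)"
      by (rule 1(2)[symmetric])
    show "(LINT x|lborel. (norm (f' x))\<^sup>2) = (l2_norm S f)\<^sup>2"
      unfolding l2_norm_square by (rule 2(2)[symmetric])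
  qed
qed

text \<open>The extension by zero may jump across the boundary of \<open>S\<close>. The weak
  gradient identity survives because it is tested only with functions supported inside
  \<open>S\<close>.\<close>

lemma weak_gradient_representative:
  assumes S: "open S" "bounded S" and v: "v \<in> L2 S" and G: "G \<in> L2 S" and w: "has_weak_gradient S v G"
  obtains u g where "integrable_weak_gradient S u g" "\<And>x. x \<notin> S \<Longrightarrow> u x = 0"
    "integrable lborel (\<lambda>x. (u x)\<^sup>2)" "integrable lborel (\<lambda>x. (norm (g x))\<^sup>2)"
    "(LINT x|lborel. u x) = (LINT x|lebesgue_on S. v x)"
    "(LINT x|lborel. (u x)\<^sup>2) = (l2_norm S v)\<^sup>2" "(LINT x|lborel. (norm (g x))\<^sup>2) = (l2_norm S G)\<^sup>2"
proof -
  have S': "S \<in> sets lebesgue" using S by auto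
  obtain u where u: "u \<in> borel_measurable borel" "AE x in lborel. indicator S x *\<^sub>R v x = u x"
    "\<And>x. x \<notin> S \<Longrightarrow> u x = 0" "integrable lborel u" "integrable lborel (\<lambda>x. (norm (u x))\<^sup>2)"
    "(LINT x|lborel. u x) = (LINT x|lebesgue_on S. v x)"
    "(LINT x|lborel. (norm (u x))\<^sup>2) = (l2_norm S v)\<^sup>2"
    by (rule L2_representative[OF S v]) (rule that; assumption)
  obtain g where g: "g \<in> borel_measurable borel" "AE x in lborel. indicator S x *\<^sub>R G x = g x"
    "\<And>x. x \<notin> S \<Longrightarrow> g x = 0" "integrable lborel g" "integrable lborel (\<lambda>x. (norm (g x))\<^sup>2)"
    "(LINT x|lborel. g x) = (LINT x|lebesgue_on S. G x)"
    "(LINT x|lborel. (norm (g x))\<^sup>2) = (l2_norm S G)\<^sup>2"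
    by (rule L2_representative[OF S G]) (rule that; assumption)
  have "integrable_weak_gradient S u g"
    unfolding integrable_weak_gradient_def
  proof (intro conjI ballI allI u(4) g(4))
    fix \<phi> i assume \<phi>: "\<phi> \<in> test_functions S"
    have b1[measurable]: "\<phi> \<in> borel_measurable borel"
      using test_function_continuous[OF \<phi>] by (rule borel_measurable_continuous_onI)
    have b2[measurable]: "(\<lambda>x. grad \<phi> x $ i) \<in> borel_measurable borel"
      using test_function_grad_continuous[OF \<phi>]
      by (auto intro!: borel_measurable_continuous_onI continuous_on_component)
    have b: "\<phi> \<in> borel_measurable (lebesgue_on S)" "(\<lambda>x. grad \<phi> x $ i) \<in> borel_measurable (lebesgue_on S)"
      by (intro measurable_restrict_space1 measurable_completion; simp)+
    have b': "(\<lambda>x. g x $ i) \<in> borel_measurable borel" "(\<lambda>x. G x $ i) \<in> borel_measurable (lebesgue_on S)"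
      using g(1) L2_D(1)[OF G] by (simp_all add: cart_eq_inner_axis)
    have 1: "(LINT x|lebesgue_on S. v x * grad \<phi> x $ i) = (LINT x|lborel. u x * grad \<phi> x $ i)"
      by (rule lebesgue_on_eq_lborel(2)[OF S'])
         (use u(1,2) L2_D(1)[OF v] b in \<open>auto simp: mult.assoc[symmetric]\<close>)
    have ae: "AE x in lborel. indicator S x *\<^sub>R (G x $ i * \<phi> x) = g x $ i * \<phi> x"
      using g(2)
    proof eventually_elim
      case (elim x)
      show ?case by (simp add: mult.assoc flip: elim)
    qed
    have 2: "(LINT x|lebesgue_on S. G x $ i * \<phi> x) = (LINT x|lborel. g x $ i * \<phi> x)"
      by (rule lebesgue_on_eq_lborel(2)[OF S'])
         (use b b' ae in auto)
    show "(LINT x|lborel. u x * grad \<phi> x $ i) = - (LINT x|lborel. g x $ i * \<phi> x)"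
      using w \<phi> 1 2 by (simp add: has_weak_gradient_def)
  qed
  with that u g show ?thesis by simp
qed

section \<open>From links to the Poincare inequality\<close>

lemma H1_wgrad:
  assumes "v \<in> H1 S"
  shows "v \<in> L2 S" "wgrad S v \<in> L2 S" "has_weak_gradient S v (wgrad S v)"
proof -
  have "\<exists>g. g \<in> L2 S \<and> has_weak_gradient S v g" using assms by (auto simp: H1_def)
  from someI_ex[OF this] show "wgrad S v \<in> L2 S" "has_weak_gradient S v (wgrad S v)"
    by (auto simp: wgrad_def)
  show "v \<in> L2 S" using assms by (simp add: H1_def)
qed

text \<open>Expand the square; the mixed term factors into a product of two integrals. This converts
  the link of \<open>S\<close> with itself into a bound on the L2 norm up to the integral of
  \<open>u\<close>.\<close>

lemma gap_self:
  fixes u :: "'a::euclidean_space \<Rightarrow> real"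
  assumes S: "S \<in> sets borel" "bounded S" and u: "integrable lborel u" "integrable lborel (\<lambda>x. (u x)\<^sup>2)"
    and 0: "\<And>x. x \<notin> S \<Longrightarrow> u x = 0"
  shows "gap u S S = ennreal (2 * measure lborel S * (LINT x|lborel. (u x)\<^sup>2) - 2 * (LINT x|lborel. u x)\<^sup>2)"
proof -
  define I where "I = (LINT x|lborel. u x)"
  define J where "J = (LINT x|lborel. (u x)\<^sup>2)"
  define m where "m = measure lborel S"
  have ind: "integrable lborel (indicator S :: 'a \<Rightarrow> real)" "(LINT x|lborel. indicator S x) = m"
    using S emeasure_bounded_finite[OF S(2)] by (auto simp: m_def)
  have eq: "indicator S y * (u x - u y)\<^sup>2 = (u x)\<^sup>2 * indicator S y - 2 * u x * u y + (u y)\<^sup>2" for x y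
    using 0[of y] by (auto simp: indicator_def power2_eq_square algebra_simps)
  have inti: "integrable lborel (\<lambda>y. indicator S y * (u x - u y)\<^sup>2)" for x
    unfolding eq using ind u by simp
  have LINTi: "(LINT y|lborel. indicator S y * (u x - u y)\<^sup>2) = m * (u x)\<^sup>2 - 2 * I * u x + J" for x
    unfolding eq using ind u by (simp add: I_def J_def)
  have inner: "(\<integral>\<^sup>+y. indicator S x * indicator S y * ennreal ((u x - u y)\<^sup>2) \<partial>lborel)
      = ennreal (m * (u x)\<^sup>2 - 2 * I * u x + J * indicator S x)" for x
  proof (cases "x \<in> S")
    case True
    have "(\<integral>\<^sup>+y. indicator S x * indicator S y * ennreal ((u x - u y)\<^sup>2) \<partial>lborel)
        = (\<integral>\<^sup>+y. ennreal (indicator S y * (u x - u y)\<^sup>2) \<partial>lborel)"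
      using True by (intro nn_integral_cong) (simp split: split_indicator)
    also have "\<dots> = ennreal (LINT y|lborel. indicator S y * (u x - u y)\<^sup>2)"
      by (rule nn_integral_eq_integral[OF inti]) simp
    finally show ?thesis using True by (simp add: LINTi)
  qed (simp add: 0)
  have int: "integrable lborel (\<lambda>x. m * (u x)\<^sup>2 - 2 * I * u x + J * indicator S x)"
    using ind u by simp
  \<comment> \<open>On \<open>S\<close> this expression is the inner integral of a square, and
    outside \<open>S\<close> it is 0. Nonnegativity is what permits the return from
    \<open>ennreal\<close> to the real integral.\<close>
  have nonneg: "m * (u x)\<^sup>2 - 2 * I * u x + J * indicator S x \<ge> 0" for x
  proof (cases "x \<in> S")
    case True
    have "0 \<le> (LINT y|lborel. indicator S y * (u x - u y)\<^sup>2)"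
      by (intro integral_nonneg_AE) auto
    with True show ?thesis by (simp add: LINTi)
  qed (simp add: 0)
  have "gap u S S = (\<integral>\<^sup>+x. ennreal (m * (u x)\<^sup>2 - 2 * I * u x + J * indicator S x) \<partial>lborel)"
    unfolding gap_def inner ..
  also have "\<dots> = ennreal (LINT x|lborel. m * (u x)\<^sup>2 - 2 * I * u x + J * indicator S x)"
    by (rule nn_integral_eq_integral[OF int]) (simp add: nonneg)
  also have "(LINT x|lborel. m * (u x)\<^sup>2 - 2 * I * u x + J * indicator S x) = 2 * m * J - 2 * I\<^sup>2"
    using ind u by (simp add: I_def J_def power2_eq_square)
  finally show ?thesis by (simp add: I_def J_def m_def)
qed

lemma poincare_lipschitz_domain:
  fixes S :: "(real^'n) set"
  assumes S: "lipschitz_domain S"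
  obtains C where "C \<ge> 0" "\<And>v. v \<in> H1 S \<Longrightarrow>
    measure lborel S * (l2_norm S v)\<^sup>2 \<le> C * (l2_norm S (wgrad S v))\<^sup>2 + (LINT x|lebesgue_on S. v x)\<^sup>2"
proof -
  have S': "open S" "bounded S" using S by (auto simp: lipschitz_domain_def)
  obtain C where C: "C \<ge> 0" "\<And>u g. integrable_weak_gradient S u g \<Longrightarrow>
      gap u S S \<le> ennreal C * (\<integral>\<^sup>+x. ennreal ((norm (g x))\<^sup>2) \<partial>lborel)"
    using linked_lipschitz_domain[OF S] unfolding linked_def by metis
  show ?thesis
  proof (rule that[of "C / 2"])
    fix v assume v: "v \<in> H1 S"
    obtain u g where ug: "integrable_weak_gradient S u g" "\<And>x. x \<notin> S \<Longrightarrow> u x = 0"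
      "integrable lborel (\<lambda>x. (u x)\<^sup>2)" "integrable lborel (\<lambda>x. (norm (g x))\<^sup>2)"
      "(LINT x|lborel. u x) = (LINT x|lebesgue_on S. v x)"
      "(LINT x|lborel. (u x)\<^sup>2) = (l2_norm S v)\<^sup>2" "(LINT x|lborel. (norm (g x))\<^sup>2) = (l2_norm S (wgrad S v))\<^sup>2"
      by (rule weak_gradient_representative[OF S' H1_wgrad[OF v]]) (rule that; assumption)
    have "integrable lborel u" using ug(1) by (simp add: integrable_weak_gradient_def)
    then have "ennreal (2 * measure lborel S * (l2_norm S v)\<^sup>2 - 2 * (LINT x|lebesgue_on S. v x)\<^sup>2) = gap u S S"
      using gap_self[of S u] ug S' by simp
    also have "\<dots> \<le> ennreal C * (\<integral>\<^sup>+x. ennreal ((norm (g x))\<^sup>2) \<partial>lborel)"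
      by (rule C(2)[OF ug(1)])
    also have "(\<integral>\<^sup>+x. ennreal ((norm (g x))\<^sup>2) \<partial>lborel) = ennreal ((l2_norm S (wgrad S v))\<^sup>2)"
      using nn_integral_eq_integral[OF ug(4)] ug(7) by simp
    also have "ennreal C * \<dots> = ennreal (C * (l2_norm S (wgrad S v))\<^sup>2)"
      using C(1) by (simp add: ennreal_mult)
    \<comment> \<open>\<open>ennreal\<close> sends negative reals to 0, but the comparison remains
      faithful because the right-hand side is nonnegative.\<close>
    finally have "2 * measure lborel S * (l2_norm S v)\<^sup>2 - 2 * (LINT x|lebesgue_on S. v x)\<^sup>2 \<le> C * (l2_norm S (wgrad S v))\<^sup>2"
      using C(1) by (subst (asm) ennreal_le_iff) auto
    then show "measure lborel S * (l2_norm S v)\<^sup>2 \<le> C / 2 * (l2_norm S (wgrad S v))\<^sup>2 + (LINT x|lebesgue_on S. v x)\<^sup>2"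
      by simp
  qed (use C in simp)
qed

section \<open>The Friedrichs inequality\<close>

lemma test_function_L2:
  assumes S: "bounded S" "S \<in> sets lebesgue" and \<phi>: "\<phi> \<in> test_functions S"
  shows "\<phi> \<in> L2 S" "grad \<phi> \<in> L2 S"
proof -
  obtain M where M: "\<And>x. \<bar>\<phi> x\<bar> \<le> M" "\<And>x. norm (grad \<phi> x) \<le> M"
    using test_function_bounded[OF \<phi>] by metis
  show "\<phi> \<in> L2 S"
    by (rule bounded_L2[OF S borel_measurable_continuous_onI[OF test_function_continuous[OF \<phi>]], of M])
       (simp add: M)
  show "grad \<phi> \<in> L2 S"
    by (rule bounded_L2[OF S borel_measurable_continuous_onI[OF test_function_grad_continuous[OF \<phi>]] M(2)])
qed

text \<open>A fixed displacement longer than the diameter leads from every point of \<open>S\<close>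
  to a zero of \<phi>, so \<phi> itself is an integral of its gradient along a segment.\<close>

lemma test_function_friedrichs:
  fixes S :: "(real^'n) set"
  assumes S: "open S" and b: "\<And>x. x \<in> S \<Longrightarrow> norm x \<le> b" and \<phi>: "\<phi> \<in> test_functions S"
  shows "(l2_norm S \<phi>)\<^sup>2 \<le> (2 * \<bar>b\<bar> + 1)\<^sup>2 * (l2_norm S (grad \<phi>))\<^sup>2"
proof -
  have bd: "bounded S" using b by (auto simp: bounded_iff)
  have S': "S \<in> sets lebesgue" using S by auto
  have m[measurable]: "\<phi> \<in> borel_measurable borel" "grad \<phi> \<in> borel_measurable borel"
    using test_function_continuous[OF \<phi>] test_function_grad_continuous[OF \<phi>]
    by (auto intro: borel_measurable_continuous_onI)
  note L2 = test_function_L2[OF bd S' \<phi>]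
  have grad0: "grad \<phi> x = 0" if "x \<notin> S" for x
    using that \<phi> by (intro test_function_grad_eq_0[OF \<phi>]) (auto simp: test_functions_def)
  have mS: "(\<lambda>x. (norm (\<phi> x))\<^sup>2) \<in> borel_measurable (lebesgue_on S)" "(\<lambda>x. (norm (grad \<phi> x))\<^sup>2) \<in> borel_measurable (lebesgue_on S)"
    using L2 by (auto dest!: L2_D(2))
  note 1 = lebesgue_on_eq_lborel[OF S' mS(1), of "\<lambda>x. (norm (\<phi> x))\<^sup>2"]
  note 2 = lebesgue_on_eq_lborel[OF S' mS(2), of "\<lambda>x. (norm (grad \<phi> x))\<^sup>2"]
  have 1: "integrable lborel (\<lambda>x. (norm (\<phi> x))\<^sup>2)" "(l2_norm S \<phi>)\<^sup>2 = (LINT x|lborel. (norm (\<phi> x))\<^sup>2)"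
    using 1 L2_D(2)[OF L2(1)] test_function_eq_0[OF \<phi>] by (auto simp: l2_norm_square indicator_def)
  have 2: "integrable lborel (\<lambda>x. (norm (grad \<phi> x))\<^sup>2)" "(l2_norm S (grad \<phi>))\<^sup>2 = (LINT x|lborel. (norm (grad \<phi> x))\<^sup>2)"
    using 2 L2_D(2)[OF L2(2)] grad0 by (auto simp: l2_norm_square indicator_def)
  \<comment> \<open>Two points of \<open>S\<close> are at most 2|b| apart; the additional 1 makes
    the displacement strictly longer, so that \<open>x + h\<close> lies outside \<open>S\<close>,
    and it keeps \<open>d\<close> positive.\<close>
  define d where "d = 2 * \<bar>b\<bar> + 1"
  obtain h :: "real^'n" where h: "norm h = d"
    using vector_choose_size[of d] by (auto simp: d_def)
  let ?\<gamma> = "\<lambda>x. ennreal ((norm (grad \<phi> x))\<^sup>2)"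
  have "ennreal ((norm (\<phi> x))\<^sup>2) \<le> (\<integral>\<^sup>+t. indicator {0..1} t * (ennreal (d\<^sup>2) * ?\<gamma> (x + t *\<^sub>R h)) \<partial>lborel)" for x
  proof (cases "x \<in> S")
    case True
    have "x + h \<notin> S"
      using b[of "x + h"] b[OF True] h norm_triangle_ineq4[of "x + h" x] by (auto simp: d_def)
    then have "\<phi> (x + h) = 0" by (rule test_function_eq_0[OF \<phi>])
    then have "- \<phi> x = (LINT t|lborel. indicator {0..1} t * (grad \<phi> (x + t *\<^sub>R h) \<bullet> h))"
      using test_function_FTC[OF \<phi>, of x h] by (simp add: mult.commute)
    then have "ennreal ((norm (\<phi> x))\<^sup>2) = ennreal ((LINT t|lborel. indicator {0..1} t * (grad \<phi> (x + t *\<^sub>R h) \<bullet> h))\<^sup>2)"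
      by (metis power2_abs power2_minus real_norm_def)
    also have "\<dots> \<le> (\<integral>\<^sup>+t. indicator {0..1} t * ennreal ((grad \<phi> (x + t *\<^sub>R h) \<bullet> h)\<^sup>2) \<partial>lborel)"
      by (rule square_integral_unit_interval_le) measurable
    also have "\<dots> \<le> (\<integral>\<^sup>+t. indicator {0..1} t * (ennreal (d\<^sup>2) * ?\<gamma> (x + t *\<^sub>R h)) \<partial>lborel)"
    proof (intro nn_integral_mono mult_left_mono)
      fix t
      have "(grad \<phi> (x + t *\<^sub>R h) \<bullet> h)\<^sup>2 \<le> d\<^sup>2 * (norm (grad \<phi> (x + t *\<^sub>R h)))\<^sup>2"
        using Cauchy_Schwarz_ineq[of "grad \<phi> (x + t *\<^sub>R h)" h] h
        by (simp add: power2_norm_eq_inner[symmetric] mult.commute)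
      then show "ennreal ((grad \<phi> (x + t *\<^sub>R h) \<bullet> h)\<^sup>2) \<le> ennreal (d\<^sup>2) * ?\<gamma> (x + t *\<^sub>R h)"
        by (simp add: ennreal_mult[symmetric] ennreal_leI)
    qed auto
    finally show ?thesis .
  qed (simp add: test_function_eq_0[OF \<phi>])
  then have "(\<integral>\<^sup>+x. ennreal ((norm (\<phi> x))\<^sup>2) \<partial>lborel)
      \<le> (\<integral>\<^sup>+x. \<integral>\<^sup>+t. indicator {0..1} t * (ennreal (d\<^sup>2) * ?\<gamma> (x + t *\<^sub>R h)) \<partial>lborel \<partial>lborel)"
    by (intro nn_integral_mono)
  also have "\<dots> = (\<integral>\<^sup>+t. \<integral>\<^sup>+x. indicator {0..1} t * (ennreal (d\<^sup>2) * ?\<gamma> (x + t *\<^sub>R h)) \<partial>lborel \<partial>lborel)"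
    by (rule lborel_pair.Fubini') measurable
  also have "\<dots> = (\<integral>\<^sup>+t. indicator {0..1::real} t * (ennreal (d\<^sup>2) * (\<integral>\<^sup>+x. ?\<gamma> x \<partial>lborel)) \<partial>lborel)"
    by (simp add: nn_integral_cmult nn_integral_lborel_translate[of ?\<gamma>])
  also have "\<dots> = ennreal (d\<^sup>2) * (\<integral>\<^sup>+x. ?\<gamma> x \<partial>lborel)"
    by (simp add: nn_integral_multc)
  also have "\<dots> = ennreal (d\<^sup>2 * (l2_norm S (grad \<phi>))\<^sup>2)"
    using nn_integral_eq_integral[OF 2(1)] 2(2) by (simp add: ennreal_mult)
  also have "(\<integral>\<^sup>+x. ennreal ((norm (\<phi> x))\<^sup>2) \<partial>lborel) = ennreal ((l2_norm S \<phi>)\<^sup>2)"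
    using nn_integral_eq_integral[OF 1(1)] 1(2) by simp
  finally show ?thesis by (subst (asm) ennreal_le_iff) (auto simp: d_def)
qed

lemma friedrichs_H10:
  fixes S :: "(real^'n) set"
  assumes S: "open S" "bounded S"
  obtains C where "C \<ge> 0" "\<And>v. v \<in> H10 S \<Longrightarrow> (l2_norm S v)\<^sup>2 \<le> C * (V_norm S v)\<^sup>2"
proof -
  obtain b where b: "\<And>x. x \<in> S \<Longrightarrow> norm x \<le> b" using S(2) by (auto simp: bounded_iff)
  have S': "S \<in> sets lebesgue" using S by auto
  define d where "d = (2 * \<bar>b\<bar> + 1)\<^sup>2"
  have d: "d \<ge> 0" by (simp add: d_def)
  show ?thesis
  \<comment> \<open>The squared triangle inequality is applied twice, to the functions and to their
    gradients; each application leaves a factor 2 in the limit.\<close>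
  proof (rule that[of "4 * d"])
    fix v assume v: "v \<in> H10 S"
    then have "v \<in> H1 S" by (simp add: H10_def)
    note L2v = H1_wgrad(1,2)[OF this]
    obtain \<phi> where \<phi>: "\<And>n::nat. \<phi> n \<in> test_functions S"
      and lim: "(\<lambda>n. l2_norm S (\<lambda>x. v x - \<phi> n x)) \<longlonglongrightarrow> 0"
        "(\<lambda>n. l2_norm S (\<lambda>x. wgrad S v x - grad (\<phi> n) x)) \<longlonglongrightarrow> 0"
      using v by (auto simp: H10_def)
    note L2 = test_function_L2[OF S(2) S' \<phi>]
    define a where "a n = l2_norm S (\<lambda>x. v x - \<phi> n x)" for n
    define a' where "a' n = l2_norm S (\<lambda>x. wgrad S v x - grad (\<phi> n) x)" for n
    have "(l2_norm S v)\<^sup>2 \<le> 2 * (a n)\<^sup>2 + 2 * (d * (2 * (a' n)\<^sup>2 + 2 * (l2_norm S (wgrad S v))\<^sup>2))" for n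
    proof -
      have "l2_norm S (\<lambda>x. grad (\<phi> n) x - wgrad S v x) = a' n"
        unfolding a'_def l2_norm_def l2_inner_def by (simp add: power2_norm_eq_inner[symmetric] norm_minus_commute)
      then have "(l2_norm S (grad (\<phi> n)))\<^sup>2 \<le> 2 * (a' n)\<^sup>2 + 2 * (l2_norm S (wgrad S v))\<^sup>2"
        using l2_norm_square_triangle[OF L2(2) L2v(2), of n] by simp
      then have "d * (l2_norm S (grad (\<phi> n)))\<^sup>2 \<le> d * (2 * (a' n)\<^sup>2 + 2 * (l2_norm S (wgrad S v))\<^sup>2)"
        using d by (intro mult_left_mono)
      moreover have "(l2_norm S (\<phi> n))\<^sup>2 \<le> d * (l2_norm S (grad (\<phi> n)))\<^sup>2"
        unfolding d_def by (rule test_function_friedrichs[OF S(1) b \<phi>])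
      moreover have "(l2_norm S v)\<^sup>2 \<le> 2 * (a n)\<^sup>2 + 2 * (l2_norm S (\<phi> n))\<^sup>2"
        unfolding a_def by (rule l2_norm_square_triangle[OF L2v(1) L2(1)])
      ultimately show ?thesis by linarith
    qed
    moreover have "(\<lambda>n. 2 * (a n)\<^sup>2 + 2 * (d * (2 * (a' n)\<^sup>2 + 2 * (l2_norm S (wgrad S v))\<^sup>2)))
        \<longlonglongrightarrow> 2 * 0\<^sup>2 + 2 * (d * (2 * 0\<^sup>2 + 2 * (l2_norm S (wgrad S v))\<^sup>2))"
      using lim unfolding a_def a'_def by (intro tendsto_intros)
    ultimately have "(l2_norm S v)\<^sup>2 \<le> 2 * 0\<^sup>2 + 2 * (d * (2 * 0\<^sup>2 + 2 * (l2_norm S (wgrad S v))\<^sup>2))"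
      by (intro LIMSEQ_le_const) auto
    then show "(l2_norm S v)\<^sup>2 \<le> 4 * d * (V_norm S v)\<^sup>2"
      by (simp add: V_norm_def)
  qed (use d in simp)
qed

section \<open>Lipschitz boundaries\<close>

text \<open>The graph is the image of the hyperplane orthogonal to \<open>e\<close>, a null set,
  under a Lipschitz map of the space into itself.\<close>

lemma negligible_lipschitz_graph:
  fixes e :: "'a::euclidean_space"
  assumes e: "norm e = 1" and lip: "L-lipschitz_on {z. z \<bullet> e = 0} \<psi>"
  shows "negligible {y. y \<bullet> e = \<psi> (y - (y \<bullet> e) *\<^sub>R e)}"
proof -
  have ee: "e \<bullet> e = 1" using e by (simp add: dot_square_norm)
  let ?H = "{z. z \<bullet> e = 0}" and ?f = "\<lambda>z. z + \<psi> z *\<^sub>R e"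
  have "negligible {z. e \<bullet> z = 0}"
    using e by (intro negligible_hyperplane) auto
  then have H: "negligible ?H" by (simp add: inner_commute)
  have "negligible (?f ` ?H)"
  proof (rule negligible_locally_Lipschitz_image[OF _ H])
    fix x assume x: "x \<in> ?H"
    have "norm (?f y - ?f x) \<le> (1 + L) * norm (y - x)" if "y \<in> ?H" for y
    proof -
      have "norm (?f y - ?f x) = norm ((y - x) + (\<psi> y - \<psi> x) *\<^sub>R e)"
        by (simp add: algebra_simps)
      also have "\<dots> \<le> norm (y - x) + \<bar>\<psi> y - \<psi> x\<bar>"
        using norm_triangle_ineq[of "y - x" "(\<psi> y - \<psi> x) *\<^sub>R e"] e by simp
      also have "\<bar>\<psi> y - \<psi> x\<bar> \<le> L * norm (y - x)"
        using lipschitz_onD[OF lip that x] by (simp add: dist_norm)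
      finally show ?thesis by (simp add: algebra_simps)
    qed
    then show "\<exists>T B. open T \<and> x \<in> T \<and> (\<forall>y\<in>?H \<inter> T. norm (?f y - ?f x) \<le> B * norm (y - x))"
      by (intro exI[of _ UNIV] exI[of _ "1 + L"]) auto
  qed simp
  moreover have "{y. y \<bullet> e = \<psi> (y - (y \<bullet> e) *\<^sub>R e)} \<subseteq> ?f ` ?H"
  proof
    fix y assume "y \<in> {y. y \<bullet> e = \<psi> (y - (y \<bullet> e) *\<^sub>R e)}"
    then have y: "\<psi> (y - (y \<bullet> e) *\<^sub>R e) = y \<bullet> e" by simp
    show "y \<in> ?f ` ?H"
      by (rule image_eqI[of _ _ "y - (y \<bullet> e) *\<^sub>R e"]) (auto simp: y ee inner_diff_left)
  qed
  ultimately show ?thesis by (rule negligible_subset)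
qed

text \<open>Inside a chart the frontier lies on the graph: its points are not below because
  \<open>S\<close> is open, and not above because points above have a neighbourhood free of
  \<open>S\<close>. Being null is a local property, so the charts suffice.\<close>

lemma negligible_frontier_lipschitz_domain:
  fixes S :: "(real^'n) set"
  assumes S: "lipschitz_domain S"
  shows "negligible (frontier S)"
proof -
  have op: "open S" using S by (simp add: lipschitz_domain_def)
  have "\<exists>U. openin (top_of_set (frontier S)) U \<and> x \<in> U \<and> negligible U" if x: "x \<in> frontier S" for x
  proof -
    from S x have "\<exists>r>0. \<exists>e \<psi> L. norm e = 1 \<and> L-lipschitz_on {z. z \<bullet> e = 0} \<psi> \<and>
        S \<inter> ball x r = {y \<in> ball x r. y \<bullet> e < \<psi> (y - (y \<bullet> e) *\<^sub>R e)}"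
      unfolding lipschitz_domain_def by (elim conjE) (erule (1) bspec)
    then obtain r e \<psi> L where r: "r > 0" and e: "norm e = 1" and lip: "L-lipschitz_on {z. z \<bullet> e = 0} \<psi>"
      and chart: "S \<inter> ball x r = {y \<in> ball x r. y \<bullet> e < \<psi> (y - (y \<bullet> e) *\<^sub>R e)}"
      by (elim exE conjE) (rule that)
    have ee: "e \<bullet> e = 1" using e by (simp add: dot_square_norm)
    let ?P = "\<lambda>y. y - (y \<bullet> e) *\<^sub>R e"
    have "y \<bullet> e = \<psi> (?P y)" if y: "y \<in> frontier S" "y \<in> ball x r" for y
    proof (rule antisym)
      have "y \<notin> S" using y(1) op by (simp add: frontier_def interior_open)
      then have "y \<notin> S \<inter> ball x r" by simp
      then show "\<psi> (?P y) \<le> y \<bullet> e" using y(2) unfolding chart by simp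
      \<comment> \<open>The points of the chart strictly above the graph form an open set disjoint
        from \<open>S\<close>, hence disjoint from its closure.\<close>
      have "continuous_on UNIV (\<psi> \<circ> ?P)"
        by (intro continuous_on_compose continuous_intros
            continuous_on_subset[OF lipschitz_on_continuous_on[OF lip]])
          (auto simp: inner_diff_left ee)
      then have "open {y. \<psi> (?P y) < y \<bullet> e}"
        by (intro open_Collect_less continuous_intros) (simp add: o_def)
      then have opn: "open ({y. \<psi> (?P y) < y \<bullet> e} \<inter> ball x r)" by (intro open_Int open_ball)
      have disj: "({y. \<psi> (?P y) < y \<bullet> e} \<inter> ball x r) \<inter> S = {}"
      proof -
        have "\<not> \<psi> (?P s) < s \<bullet> e" if "s \<in> S \<inter> ball x r" for s
          using that unfolding chart by simp
        then show ?thesis by blast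
      qed
      have "y \<in> closure S" using y(1) by (simp add: frontier_def)
      then have "y \<notin> {y. \<psi> (?P y) < y \<bullet> e} \<inter> ball x r"
        using open_Int_closure_eq_empty[OF opn, of S] disj by blast
      with y(2) show "y \<bullet> e \<le> \<psi> (?P y)" by simp
    qed
    then have "negligible (frontier S \<inter> ball x r)"
      by (intro negligible_subset[OF negligible_lipschitz_graph[OF e lip]]) auto
    moreover have "openin (top_of_set (frontier S)) (frontier S \<inter> ball x r)"
      by (intro openin_open_Int open_ball)
    ultimately show ?thesis using x r by (intro exI[of _ "frontier S \<inter> ball x r"]) auto
  qed
  then show ?thesis using locally_negligible_alt[of "frontier S"] by blast
qed

section \<open>Coercivity\<close>

text \<open>The lower bound is pointwise; the essential bound on \<beta> supplies the integrability
  of the weighted square, without which the Bochner integral would default to 0.\<close>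

lemma l2_inner_weighted_ge:
  fixes G :: "'a::euclidean_space \<Rightarrow> 'b::euclidean_space"
  assumes \<beta>: "\<beta> \<in> Linfty S" and m: "AE x in lebesgue_on S. m \<le> \<beta> x" and G: "G \<in> L2 S"
  shows "m * (l2_norm S G)\<^sup>2 \<le> l2_inner S (\<lambda>x. \<beta> x *\<^sub>R G x) G"
proof -
  have mm: "\<beta> \<in> borel_measurable (lebesgue_on S)" "G \<in> borel_measurable (lebesgue_on S)"
    using \<beta> G by (auto simp: Linfty_def L2_D)
  obtain M where M: "AE x in lebesgue_on S. \<bar>\<beta> x\<bar> \<le> M" using \<beta> by (auto simp: Linfty_def)
  have int: "integrable (lebesgue_on S) (\<lambda>x. \<beta> x * (norm (G x))\<^sup>2)"
  proof (rule Bochner_Integration.integrable_bound)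
    show "integrable (lebesgue_on S) (\<lambda>x. M * (norm (G x))\<^sup>2)" using L2_D(2)[OF G] by simp
    show "(\<lambda>x. \<beta> x * (norm (G x))\<^sup>2) \<in> borel_measurable (lebesgue_on S)"
      using mm by measurable
    show "AE x in lebesgue_on S. norm (\<beta> x * (norm (G x))\<^sup>2) \<le> norm (M * (norm (G x))\<^sup>2)"
      using M by eventually_elim (auto simp: abs_mult intro!: mult_right_mono)
  qed
  have "(LINT x|lebesgue_on S. m * (norm (G x))\<^sup>2) \<le> (LINT x|lebesgue_on S. \<beta> x * (norm (G x))\<^sup>2)"
  proof (rule integral_mono_AE[OF _ int])
    show "AE x in lebesgue_on S. m * (norm (G x))\<^sup>2 \<le> \<beta> x * (norm (G x))\<^sup>2"
      using m by eventually_elim (auto intro: mult_right_mono)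
  qed (use L2_D(2)[OF G] in simp)
  then show ?thesis by (simp add: l2_norm_square l2_inner_def power2_norm_eq_inner)
qed

lemma Linfty_diff:
  assumes "f \<in> Linfty S" "g \<in> Linfty S"
  shows "(\<lambda>x. f x - g x) \<in> Linfty S"
proof -
  obtain M N where "AE x in lebesgue_on S. \<bar>f x\<bar> \<le> M" "AE x in lebesgue_on S. \<bar>g x\<bar> \<le> N"
    using assms by (auto simp: Linfty_def)
  then have "AE x in lebesgue_on S. \<bar>f x - g x\<bar> \<le> M + N"
    by eventually_elim linarith
  then show ?thesis using assms by (auto simp: Linfty_def)
qed

lemma AE_lebesgue_on_iff:
  "S \<in> sets lebesgue \<Longrightarrow> (AE x in lebesgue_on S. P x) \<longleftrightarrow> (AE x in lebesgue. x \<in> S \<longrightarrow> P x)"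
  by (subst AE_restrict_space_iff) auto

lemma Linfty_subset:
  assumes "f \<in> Linfty S" "T \<subseteq> S" "S \<in> sets lebesgue" "T \<in> sets lebesgue"
  shows "f \<in> Linfty T"
proof -
  obtain M where "AE x in lebesgue_on S. \<bar>f x\<bar> \<le> M"
    using assms by (auto simp: Linfty_def)
  then have "AE x in lebesgue_on T. \<bar>f x\<bar> \<le> M"
    using assms(2-4) by (auto simp: AE_lebesgue_on_iff elim!: eventually_mono)
  moreover have "f \<in> borel_measurable (lebesgue_on S)"
    using assms(1) by (simp add: Linfty_def)
  then have "f \<in> borel_measurable (lebesgue_on T)"
    using assms(2) by (rule measurable_restrict_mono)
  ultimately show ?thesis unfolding Linfty_def by blast
qed

lemma L2_subset:
  fixes f :: "'a::euclidean_space \<Rightarrow> 'b::euclidean_space"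
  assumes f: "f \<in> L2 S" and TS: "T \<subseteq> S" and S: "S \<in> sets lebesgue" and T: "T \<in> sets lebesgue"
  shows "f \<in> L2 T" "(l2_norm T f)\<^sup>2 \<le> (l2_norm S f)\<^sup>2"
proof -
  have m: "f \<in> borel_measurable (lebesgue_on T)"
    using measurable_restrict_mono[OF L2_D(1)[OF f] TS] .
  have "integrable lebesgue (\<lambda>x. indicator T x *\<^sub>R (indicator S x *\<^sub>R (norm (f x))\<^sup>2))"
    by (rule integrable_mult_indicator) (use L2_D(2)[OF f] S T in \<open>simp_all add: integrable_restrict_space\<close>)
  also have "(\<lambda>x. indicator T x *\<^sub>R (indicator S x *\<^sub>R (norm (f x))\<^sup>2)) = (\<lambda>x. indicator T x *\<^sub>R (norm (f x))\<^sup>2)"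
    using TS by (intro ext) (auto split: split_indicator)
  finally have "integrable (lebesgue_on T) (\<lambda>x. (norm (f x))\<^sup>2)"
    using T by (simp add: integrable_restrict_space)
  with m show "f \<in> L2 T" by (simp add: L2_def)
  show "(l2_norm T f)\<^sup>2 \<le> (l2_norm S f)\<^sup>2"
    unfolding l2_norm_square
    by (rule integral_mono_lebesgue_on_AE[OF L2_D(2)[OF f]]) (use TS S T in auto)
qed

lemma square_integral_le_l2_norm:
  fixes f :: "'a::euclidean_space \<Rightarrow> real"
  assumes S: "bounded S" "S \<in> sets lebesgue" and f: "f \<in> L2 S" and pos: "measure lebesgue S > 0"
  shows "(LINT x|lebesgue_on S. f x)\<^sup>2 \<le> measure lebesgue S * (l2_norm S f)\<^sup>2"
proof -
  define I where "I = (LINT x|lebesgue_on S. f x)"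
  define m where "m = measure lebesgue S"
  note int = L2_integrable[OF S f] L2_D(2)[OF f] integrable_lebesgue_on_const[OF S]
  have c: "measure (lebesgue_on S) S = m"
    using S(2) by (simp add: measure_restrict_space m_def)
  \<comment> \<open>Cauchy-Schwarz against the constant 1, read off from the deviation of
    \<open>f\<close> from its mean \<open>I / m\<close>, scaled by \<open>m\<close>. Expansion
    yields \<open>m\<close> times the claimed difference, and \<open>m\<close> is positive.\<close>
  have "0 \<le> (LINT x|lebesgue_on S. (m * f x - I)\<^sup>2)" by simp
  also have "\<dots> = (LINT x|lebesgue_on S. m\<^sup>2 * (norm (f x))\<^sup>2 - 2 * m * I * f x + I\<^sup>2)"
    by (intro Bochner_Integration.integral_cong) (auto simp: power2_eq_square algebra_simps)
  also have "\<dots> = m\<^sup>2 * (l2_norm S f)\<^sup>2 - 2 * m * I * I + I\<^sup>2 * m"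
    using int S(2) by (simp add: c l2_norm_square I_def[symmetric])
  also have "\<dots> = m * (m * (l2_norm S f)\<^sup>2 - I\<^sup>2)"
    by (simp add: power2_eq_square algebra_simps)
  finally have "0 \<le> m * (l2_norm S f)\<^sup>2 - I\<^sup>2"
    using pos by (simp add: m_def zero_le_mult_iff)
  then show ?thesis by (simp add: m_def I_def)
qed

lemma K_h_integral_eq:
  assumes S: "open \<Omega>2" "bounded \<Omega>2" and K: "(v, v2) \<in> K_h el \<Omega> \<Omega>2 T T2"
    and L2: "v \<in> L2 \<Omega>2" "v2 \<in> L2 \<Omega>2"
  shows "(LINT x|lebesgue_on \<Omega>2. v x) = (LINT x|lebesgue_on \<Omega>2. v2 x)"
proof -
  have S': "\<Omega>2 \<in> sets lebesgue" using S by auto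
  have "(\<lambda>x. 1 :: real) \<in> L2 \<Omega>2"
    by (rule bounded_L2[OF S(2) S', of _ 1]) auto
  moreover have "(\<lambda>x. 1 :: real) \<in> piecewise P0_space T2"
    by (auto simp: piecewise_def P0_space_def intro!: bexI[of _ "\<lambda>x. 1 :: real"])
  ultimately have "(\<lambda>x. 1 :: real) \<in> Lambda_h \<Omega>2 T2" by (simp add: Lambda_h_def)
  then have "l2_inner \<Omega>2 (\<lambda>x. 1 :: real) (\<lambda>x. v x - v2 x) = 0"
    using K unfolding K_h_def by blast
  then show ?thesis
    using L2_integrable[OF S(2) S' L2(1)] L2_integrable[OF S(2) S' L2(2)] by (simp add: l2_inner_def)
qed

lemma interface_configurationD:
  assumes "interface_configuration \<Omega> \<Omega>1 \<Omega>2"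
  shows "lipschitz_domain \<Omega>" "lipschitz_domain \<Omega>2" "open \<Omega>1" "\<Omega>2 \<subseteq> \<Omega>"
    "\<Omega> \<subseteq> \<Omega>1 \<union> \<Omega>2 \<union> frontier \<Omega>2"
proof -
  have c: "lipschitz_domain \<Omega>" "lipschitz_domain \<Omega>2" "open \<Omega>1" "closure \<Omega>2 \<subseteq> \<Omega>"
    "\<Omega>1 \<inter> \<Omega>2 = {}" "\<Omega> = \<Omega>1 \<union> (closure \<Omega>1 \<inter> closure \<Omega>2) \<union> \<Omega>2"
    using assms by (auto simp: interface_configuration_def Let_def)
  then show "lipschitz_domain \<Omega>" "lipschitz_domain \<Omega>2" "open \<Omega>1" by auto
  show "\<Omega>2 \<subseteq> \<Omega>" using c(6) by blast
  have "open \<Omega>2" using c(2) by (simp add: lipschitz_domain_def)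
  then have "frontier \<Omega>2 = closure \<Omega>2 - \<Omega>2" by (simp add: frontier_def interior_open)
  then show "\<Omega> \<subseteq> \<Omega>1 \<union> \<Omega>2 \<union> frontier \<Omega>2" using c(6) by blast
qed

theorem proposition3p1:
  fixes \<Omega> \<Omega>1 \<Omega>2 :: "(real^'n) set"
    and \<beta> \<beta>1 \<beta>2 :: "real^'n \<Rightarrow> real"
    and \<beta>1_low \<beta>2_low \<beta>_low \<sigma> :: real
    and el :: fe_choice
  assumes "CARD('n) \<in> {1, 2, 3}"
    and "interface_configuration \<Omega> \<Omega>1 \<Omega>2"
    and "\<beta> \<in> Linfty \<Omega>" and "\<beta>1 \<in> Linfty \<Omega>1" and "\<beta>2 \<in> Linfty \<Omega>2"
    and "AE x in lebesgue_on \<Omega>1. \<beta> x = \<beta>1 x"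
    and "\<beta>1_low > 0" and "AE x in lebesgue_on \<Omega>1. \<beta>1 x > \<beta>1_low"
    and "\<beta>2_low > 0" and "AE x in lebesgue_on \<Omega>2. \<beta>2 x > \<beta>2_low"
    and "\<beta>_low > 0" and "AE x in lebesgue_on \<Omega>2. \<beta> x > \<beta>_low"
    and "ess_greater \<Omega>2 \<beta>2 \<beta>"
  shows "\<exists>\<gamma>1>0. \<forall>T T2.
    mesh \<Omega> T \<and> shape_regular \<sigma> T \<and> mesh \<Omega>2 T2 \<and> shape_regular \<sigma> T2 \<longrightarrow>
    (\<forall>(v, v2)\<in>K_h el \<Omega> \<Omega>2 T T2.
       l2_inner \<Omega> (\<lambda>x. \<beta> x *\<^sub>R wgrad \<Omega> v x) (wgrad \<Omega> v)
       + l2_inner \<Omega>2 (\<lambda>x. (\<beta>2 x - \<beta> x) *\<^sub>R wgrad \<Omega>2 v2 x) (wgrad \<Omega>2 v2)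
       \<ge> \<gamma>1 * ((V_norm \<Omega> v)\<^sup>2 + (h1_norm \<Omega>2 v2)\<^sup>2))"
proof -
  note conf = interface_configurationD[OF assms(2)]
  have \<Omega>: "open \<Omega>" "bounded \<Omega>" and \<Omega>2: "open \<Omega>2" "bounded \<Omega>2" "\<Omega>2 \<noteq> {}"
    using conf(1,2) by (auto simp: lipschitz_domain_def)
  have sets: "\<Omega> \<in> sets lebesgue" "\<Omega>1 \<in> sets lebesgue" "\<Omega>2 \<in> sets lebesgue"
    using \<Omega> \<Omega>2 conf(3) by auto
  define m where "m = min \<beta>1_low \<beta>_low"
  have m: "m > 0" using assms(7,11) by (simp add: m_def)
  \<comment> \<open>\<beta> exceeds \<open>\<beta>1_low\<close> almost everywhere on \<Omega>1,
    through \<beta>1, and \<open>\<beta>_low\<close> on \<Omega>2. The remaining points of \<Omega>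
    lie on the frontier of \<Omega>2, which must be null for the bound by \<open>m\<close> to hold
    almost everywhere on \<Omega>.\<close>
  have "frontier \<Omega>2 \<in> null_sets lebesgue"
    using negligible_frontier_lipschitz_domain[OF conf(2)] by (simp add: negligible_iff_null_sets)
  then have "AE x in lebesgue. x \<notin> frontier \<Omega>2" by (rule AE_not_in)
  then have "AE x in lebesgue. x \<in> \<Omega> \<longrightarrow> m \<le> \<beta> x"
    using assms(6,8,12) unfolding AE_lebesgue_on_iff[OF sets(2)] AE_lebesgue_on_iff[OF sets(3)]
    by eventually_elim (use conf(5) in \<open>force simp: m_def\<close>)
  then have \<beta>m: "AE x in lebesgue_on \<Omega>. m \<le> \<beta> x" by (simp add: AE_lebesgue_on_iff[OF sets(1)])
  obtain \<delta> where \<delta>1: "\<delta> > 0" "AE x in lebesgue_on \<Omega>2. \<beta>2 x \<ge> \<beta> x + \<delta>"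
    using assms(13) unfolding ess_greater_def by blast
  from \<delta>1(2) have "AE x in lebesgue_on \<Omega>2. \<delta> \<le> \<beta>2 x - \<beta> x"
    by eventually_elim simp
  note \<delta> = \<delta>1(1) this
  have diff: "(\<lambda>x. \<beta>2 x - \<beta> x) \<in> Linfty \<Omega>2"
    by (intro Linfty_diff assms(5) Linfty_subset[OF assms(3) conf(4) sets(1,3)])
  obtain F where F: "F \<ge> 0" "\<And>v. v \<in> H10 \<Omega> \<Longrightarrow> (l2_norm \<Omega> v)\<^sup>2 \<le> F * (V_norm \<Omega> v)\<^sup>2"
    using friedrichs_H10[OF \<Omega>] by metis
  obtain C where C: "C \<ge> 0" "\<And>v. v \<in> H1 \<Omega>2 \<Longrightarrow>
      measure lborel \<Omega>2 * (l2_norm \<Omega>2 v)\<^sup>2 \<le> C * (l2_norm \<Omega>2 (wgrad \<Omega>2 v))\<^sup>2 + (LINT x|lebesgue_on \<Omega>2. v x)\<^sup>2"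
    using poincare_lipschitz_domain[OF conf(2)] by metis
  define \<mu> where "\<mu> = measure lebesgue \<Omega>2"
  have \<mu>: "\<mu> > 0" "measure lborel \<Omega>2 = \<mu>"
  proof -
    show "measure lborel \<Omega>2 = \<mu>" using \<Omega>2 by (simp add: \<mu>_def)
    obtain x r where "r > 0" "ball x r \<subseteq> \<Omega>2" using \<Omega>2 by (meson all_not_in_conv openE)
    then have "measure lebesgue (ball x r) \<le> \<mu>"
      unfolding \<mu>_def using \<Omega>2 by (intro measure_mono_fmeasurable) (auto intro: bounded_set_imp_lmeasurable)
    moreover have "measure lebesgue (ball x r) > 0"
      using \<open>r > 0\<close> by simp
    ultimately show "\<mu> > 0" by linarith
  qed
  \<comment> \<open>Let a and b be the squared L2 norms of the gradients of \<open>v\<close> on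
    \<Omega> and \<open>v2\<close> on \<Omega>2. The squared L2 norm of \<open>v2\<close> is at most
    (C/\<mu>) b + F a, so the bracket to be controlled is at most (1 + F) a + (1 + C/\<mu>) b, while
    the form is at least m a + \<delta> b. Comparing coefficients gives \<gamma>, built from
    constants of the domains and the coefficients alone.\<close>
  define \<gamma> where "\<gamma> = min (m / (1 + F)) (\<delta> / (1 + C / \<mu>))"
  have C\<mu>: "C / \<mu> \<ge> 0" using C(1) \<mu>(1) by simp
  have \<gamma>: "\<gamma> > 0" using m F(1) \<delta>(1) C\<mu> by (simp add: \<gamma>_def)
  have \<gamma>le: "\<gamma> * (1 + F) \<le> m" "\<gamma> * (1 + C / \<mu>) \<le> \<delta>"
  proof -
    have "\<gamma> * (1 + F) \<le> m / (1 + F) * (1 + F)" "\<gamma> * (1 + C / \<mu>) \<le> \<delta> / (1 + C / \<mu>) * (1 + C / \<mu>)"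
      using F(1) C\<mu> by (intro mult_right_mono; simp add: \<gamma>_def)+
    then show "\<gamma> * (1 + F) \<le> m" "\<gamma> * (1 + C / \<mu>) \<le> \<delta>"
      using F(1) C\<mu> by auto
  qed
  have main: "\<gamma> * ((V_norm \<Omega> v)\<^sup>2 + (h1_norm \<Omega>2 v2)\<^sup>2)
      \<le> l2_inner \<Omega> (\<lambda>x. \<beta> x *\<^sub>R wgrad \<Omega> v x) (wgrad \<Omega> v)
       + l2_inner \<Omega>2 (\<lambda>x. (\<beta>2 x - \<beta> x) *\<^sub>R wgrad \<Omega>2 v2 x) (wgrad \<Omega>2 v2)"
    if K: "(v, v2) \<in> K_h el \<Omega> \<Omega>2 T T2" for v v2 T T2
  proof -
    have v: "v \<in> H10 \<Omega>" and v2: "v2 \<in> H1 \<Omega>2"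
      using K by (cases el; auto simp: K_h_def)+
    then have v': "v \<in> H1 \<Omega>" by (simp add: H10_def)
    define a where "a = (V_norm \<Omega> v)\<^sup>2"
    define b where "b = (l2_norm \<Omega>2 (wgrad \<Omega>2 v2))\<^sup>2"
    have vL2: "v \<in> L2 \<Omega>2" "(l2_norm \<Omega>2 v)\<^sup>2 \<le> (l2_norm \<Omega> v)\<^sup>2"
      using L2_subset[OF H1_wgrad(1)[OF v'] conf(4) sets(1,3)] by auto
    have "\<mu> * (l2_norm \<Omega>2 v2)\<^sup>2 \<le> C * b + (LINT x|lebesgue_on \<Omega>2. v2 x)\<^sup>2"
      using C(2)[OF v2] by (simp add: b_def \<mu>)
    also have "(LINT x|lebesgue_on \<Omega>2. v2 x)\<^sup>2 = (LINT x|lebesgue_on \<Omega>2. v x)\<^sup>2"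
      using K_h_integral_eq[OF \<Omega>2(1,2) K vL2(1) H1_wgrad(1)[OF v2]] by simp
    also have "\<dots> \<le> \<mu> * (l2_norm \<Omega>2 v)\<^sup>2"
      using square_integral_le_l2_norm[OF \<Omega>2(2) sets(3) vL2(1)] \<mu>(1) by (simp add: \<mu>_def)
    also have "\<dots> \<le> \<mu> * (F * a)"
      using order_trans[OF vL2(2) F(2)[OF v]] \<mu>(1) by (simp add: a_def)
    finally have "\<mu> * (l2_norm \<Omega>2 v2)\<^sup>2 \<le> \<mu> * (C / \<mu> * b + F * a)"
      using \<mu>(1) by (simp add: algebra_simps)
    then have c: "(l2_norm \<Omega>2 v2)\<^sup>2 \<le> C / \<mu> * b + F * a"
      using \<mu>(1) by (simp only: mult_le_cancel_left_pos)
    have "(h1_norm \<Omega>2 v2)\<^sup>2 = (l2_norm \<Omega>2 v2)\<^sup>2 + b"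
      by (simp add: h1_norm_def b_def)
    then have "\<gamma> * (a + (h1_norm \<Omega>2 v2)\<^sup>2) \<le> \<gamma> * ((1 + F) * a + (1 + C / \<mu>) * b)"
      using c \<gamma> by (intro mult_left_mono) (auto simp: algebra_simps)
    also have "\<dots> = (\<gamma> * (1 + F)) * a + (\<gamma> * (1 + C / \<mu>)) * b"
      by (simp only: distrib_left[of \<gamma> "(1 + F) * a"] mult.assoc)
    also have "\<dots> \<le> m * a + \<delta> * b"
      by (intro add_mono mult_right_mono \<gamma>le) (auto simp: a_def b_def)
    also have "m * a \<le> l2_inner \<Omega> (\<lambda>x. \<beta> x *\<^sub>R wgrad \<Omega> v x) (wgrad \<Omega> v)"
      unfolding a_def V_norm_def by (rule l2_inner_weighted_ge[OF assms(3) \<beta>m H1_wgrad(2)[OF v']])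
    also have "\<delta> * b \<le> l2_inner \<Omega>2 (\<lambda>x. (\<beta>2 x - \<beta> x) *\<^sub>R wgrad \<Omega>2 v2 x) (wgrad \<Omega>2 v2)"
      unfolding b_def by (rule l2_inner_weighted_ge[OF diff \<delta>(2) H1_wgrad(2)[OF v2]])
    finally show ?thesis by (simp add: a_def)
  qed
  show ?thesis
    using \<gamma> main by (intro exI[of _ \<gamma>]) blast
qed

end
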